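(* Let $f_1,\dots,f_r\in\mathbb{C}[Z_1,\dots,Z_n]$ and $I=\langle f_1,\dots,f_r\rangle$. The point $(0,\dots,0)\in\mathbb{T}^n$ is contained in the complement of the (modified) coamoeba $\mathcal{C}'_I$ if and only if there exists a polynomial identity $$\sum_{j=1}^r c_j\cdot f_j(X^2,Y)^{\mathrm{re}}+\sum_{j=1}^r c_j'\cdot f_j(X^2,Y)^{\mathrm{im}}+\sum_{k=1}^n d_k\cdot Y_k+H+1=0$$ with polynomials $c_j,c_j',d_k\in\mathbb{R}[X,Y]$ and a sum of squares polynomial $H\in\mathbb{R}[X,Y]$.
   Context: $\mathbb{R}[X,Y]=\mathbb{R}[X_1,\dots,X_n,Y_1,\dots,Y_n]$ and $\mathbb{T}^n=(\mathbb{R}/2\pi\mathbb{Z})^n$. For $f\in\mathbb{C}[Z_1,\dots,Z_n]$, the real and imaginary parts $f^{\mathrm{re}},f^{\mathrm{im}}\in\mathbb{R}[X,Y]$ are defined by $f(X+iY)=f^{\mathrm{re}}(X,Y)+i\,f^{\mathrm{im}}(X,Y)$. The notation $f_j(X^2,Y)^{\mathrm{re}}$ (resp. $f_j(X^2,Y)^{\mathrm{im}}$) means $f_j^{\mathrm{re}}(X_1^2,\dots,X_n^2,Y_1,\dots,Y_n)$ (resp. $f_j^{\mathrm{im}}(X_1^2,\dots,X_n^2,Y_1,\dots,Y_n)$). With $\mathcal{V}(I)\subset\mathbb{C}^n$ the complex variety of $I$, the modified coamoeba is $$\mathcal{C}'_I=\{\phi\in\mathbb{T}^n : \exists z\in\mathcal{V}(I):\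 \text{for every } 1\le j\le n,\ \arg(z_j)=\phi_j \text{ or } z_j=0\}.$$ A sum of squares polynomial is a finite sum of squares of polynomials in $\mathbb{R}[X,Y]$. *)

theory Defs
  imports "HOL-Analysis.Analysis" "HOL-Library.Poly_Mapping"
begin

text \<open>
  A monomial is a finitely supported exponent vector and a polynomial a finitely supported
  family of coefficients; the ring structure is the convolution product of
  \<^theory>\<open>HOL-Library.Poly_Mapping\<close>.
\<close>

type_synonym ('v, 'a) mpoly = "('v \<Rightarrow>\<^sub>0 nat) \<Rightarrow>\<^sub>0 'a"

definition mconst :: "'a::zero \<Rightarrow> ('v, 'a) mpoly" where
  "mconst c = Poly_Mapping.single 0 c"

definition mvar :: "'v \<Rightarrow> ('v, 'a::zero_neq_one) mpoly" where
  "mvar v = Poly_Mapping.single (Poly_Mapping.single v 1) 1"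

text \<open>
  Replaces each variable \<open>v\<close> by \<open>x v\<close> and maps the coefficients by \<open>h\<close>. It serves both as
  evaluation at a point (\<open>h\<close> the identity) and as substitution of polynomials (\<open>h = mconst\<close>).
\<close>

definition meval ::
    "('a::zero \<Rightarrow> 'b) \<Rightarrow> ('v \<Rightarrow> 'b) \<Rightarrow> ('v, 'a) mpoly \<Rightarrow> 'b::comm_semiring_1" where
  "meval h x p = (\<Sum>m\<in>Poly_Mapping.keys p. h (Poly_Mapping.lookup p m) *
     (\<Prod>v\<in>Poly_Mapping.keys m. x v ^ Poly_Mapping.lookup m v))"

definition sum_of_squares :: "('v, real) mpoly \<Rightarrow> bool" where
  "sum_of_squares H \<longleftrightarrow> (\<exists>qs. H = (\<Sum>q\<leftarrow>qs. q\<^sup>2))"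

text \<open>
  The \<open>n\<close> complex variables are indexed by a finite type \<open>'n\<close>; the \<open>2n\<close> real variables
  are indexed by \<open>'n + 'n\<close>, the left summand for \<open>X\<close> and the right one for \<open>Y\<close>.
\<close>

abbreviation X :: "'n \<Rightarrow> ('n + 'n, 'a::zero_neq_one) mpoly" where
  "X k \<equiv> mvar (Inl k)"

abbreviation Y :: "'n \<Rightarrow> ('n + 'n, 'a::zero_neq_one) mpoly" where
  "Y k \<equiv> mvar (Inr k)"

definition subst_XiY :: "('n, complex) mpoly \<Rightarrow> ('n + 'n, complex) mpoly" where
  "subst_XiY f = meval mconst (\<lambda>k. X k + mconst \<i> * Y k) f"

definition re_part :: "('n, complex) mpoly \<Rightarrow> ('n + 'n, real) mpoly" where
  "re_part f = Poly_Mapping.map Re (subst_XiY f)"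

definition im_part :: "('n, complex) mpoly \<Rightarrow> ('n + 'n, real) mpoly" where
  "im_part f = Poly_Mapping.map Im (subst_XiY f)"

lemma re_im_part_unique:
  fixes f :: "('n, complex) mpoly" and u v :: "('n + 'n, real) mpoly"
  shows "subst_XiY f =
           Poly_Mapping.map of_real u + mconst \<i> * Poly_Mapping.map of_real v
         \<longleftrightarrow> u = re_part f \<and> v = im_part f"
proof -
  have i: "Poly_Mapping.lookup (mconst \<i> * p) m = \<i> * Poly_Mapping.lookup p m"
    for p :: "('n + 'n, complex) mpoly" and m
    unfolding mconst_def mult_map_scale_conv_mult [symmetric] map.rep_eq
    by (simp add: "when_def")
  have l: "Poly_Mapping.lookup (Poly_Mapping.map of_real p) m
      = (of_real (Poly_Mapping.lookup p m) :: complex)" for p :: "('n + 'n, real) mpoly" and m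
    by (simp add: map.rep_eq "when_def")
  have re: "Poly_Mapping.lookup (re_part f) m = Re (Poly_Mapping.lookup (subst_XiY f) m)"
    and im: "Poly_Mapping.lookup (im_part f) m = Im (Poly_Mapping.lookup (subst_XiY f) m)" for m
    by (simp_all add: re_part_def im_part_def map.rep_eq "when_def")
  show ?thesis
    unfolding poly_mapping_eq_iff fun_eq_iff lookup_add i l re im complex_eq_iff
    by (simp add: all_conj_distrib) metis
qed

definition subst_X2Y :: "('n + 'n, real) mpoly \<Rightarrow> ('n + 'n, real) mpoly" where
  "subst_X2Y p = meval mconst (case_sum (\<lambda>k. (X k)\<^sup>2) (\<lambda>k. Y k)) p"

quotient_type angle = real / "\<lambda>x y. \<exists>k::int. x - y = 2 * pi * of_int k"
proof (rule equivpI)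
  show "reflp (\<lambda>x y. \<exists>k::int. x - y = 2 * pi * of_int k)"
    by (rule reflpI) (auto intro: exI [of _ 0])
  show "symp (\<lambda>x y. \<exists>k::int. x - y = 2 * pi * of_int k)"
  proof (rule sympI)
    fix x y :: real
    assume "\<exists>k::int. x - y = 2 * pi * of_int k"
    then obtain k :: int where "x - y = 2 * pi * of_int k" ..
    then have "y - x = 2 * pi * of_int (- k)" by (simp add: algebra_simps)
    then show "\<exists>k::int. y - x = 2 * pi * of_int k" ..
  qed
  show "transp (\<lambda>x y. \<exists>k::int. x - y = 2 * pi * of_int k)"
  proof (rule transpI)
    fix x y z :: real
    assume "\<exists>k::int. x - y = 2 * pi * of_int k" "\<exists>k::int. y - z = 2 * pi * of_int k"
    then obtain k l :: int
      where "x - y = 2 * pi * of_int k" "y - z = 2 * pi * of_int l" by blast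
    then have "x - z = 2 * pi * of_int (k + l)" by (simp add: algebra_simps)
    then show "\<exists>k::int. x - z = 2 * pi * of_int k" ..
  qed
qed

instantiation angle :: zero
begin

lift_definition zero_angle :: angle is 0 .

instance ..

end

text \<open>Only meaningful for nonzero arguments; at \<open>0\<close> it inherits the convention of \<^const>\<open>Arg\<close>.\<close>

lift_definition arg :: "complex \<Rightarrow> angle" is Arg .

text \<open>Ideals are the submodules of the ring, regarded as a module over itself.\<close>

definition ideal_of :: "('n, complex) mpoly set \<Rightarrow> ('n, complex) mpoly set" where
  "ideal_of F = module.span (*) F"

definition variety :: "('n::finite, complex) mpoly set \<Rightarrow> (complex ^ 'n) set" where
  "variety I = {z. \<forall>f\<in>I. meval id (($) z) f = 0}"

definition modified_coamoeba :: "('n::finite, complex) mpoly set \<Rightarrow> (angle ^ 'n) set" where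
  "modified_coamoeba I =
     {\<phi>. \<exists>z\<in>variety I. \<forall>j. arg (z $ j) = \<phi> $ j \<or> z $ j = 0}"

end

theory Submission
  imports Defs "HOL-Algebra.Algebraic_Closure_Type"
begin

text \<open>
  A point of the coamoeba at \<open>0\<close> is a point of the variety with nonnegative real coordinates, that
  is, a common real zero of the polynomials \<open>f\<^sub>j(X\<^sup>2, Y)\<close> and \<open>Y\<^sub>k\<close>. So the theorem is the weak real
  Nullstellensatz for the sum \<open>g\<close> of the squares of these polynomials.

  If \<open>-1\<close> is not a sum of squares modulo \<open>g\<close>, then \<open>g\<close> lies in a real prime ideal. Its coordinate
  ring embeds into a real closed field \<open>K\<close>, a maximal formally real subring of the algebraic closure
  of the fraction field, so \<open>g\<close> has a zero over \<open>K\<close>. It is moved to the real numbers one coordinate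
  at a time, by approximating the signs of finitely many polynomials at the given point of
  \<open>K\<^sup>n\<close>. For the step, the partial real points that have been found so far form a filter, and
  a maximal ring of pairs \<open>(k, \<rho>)\<close>, where \<open>\<rho>\<close> is a real function of these points whose sign is
  eventually that of \<open>k \<in> K\<close>, contains all roots in \<open>K\<close> of the polynomials over it: by induction on
  the degree the roots of the derivative are already there, between them a polynomial is monotone,
  and hence a root in \<open>K\<close> and the corresponding real roots can be adjoined.
\<close>

section \<open>Real closed fields\<close>

hide_const (open) Polynomials.degree Polynomials.lead_coeff up_ring.coeff up_ring.monom Coset.order module.smult

text \<open>The obstacle is the passage from \<open>K\<close> to the reals. \<open>K\<close> may
  contain infinitesimals and need not admit any homomorphism to the reals, so a zero over
  \<open>K\<close> cannot be pushed down. What survives is that finitely many sign conditions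
  satisfied in \<open>K\<close> can be satisfied by real numbers. One real point can match only
  finitely many polynomials, hence the filter generated by all conditions at once: an eventual
  assertion depends on finitely many of them and therefore holds somewhere. At the next coordinate a
  root in \<open>K\<close> has to be matched by a real root that varies with the point chosen so
  far, which is why elements of \<open>K\<close> are paired with functions. Real closedness is taken
  to be the intermediate value property of polynomials, because Rolle's theorem and the sign change
  at a simple root follow from it by pure algebra, for \<open>K\<close> and for the reals alike. For
  \<open>K\<close> itself the property comes from maximality: a polynomial that changes sign without
  a root would lead to an algebraic element whose adjunction destroys realness, and the vanishing
  sum of squares that witnesses this is made as small as possible in degree.\<close>

class real_closed_field = linordered_field +
  assumes sum_powers_ivt: "a < b \<Longrightarrow> (\<Sum>k\<le>n. c k * a ^ k) < 0 \<Longrightarrow> 0 < (\<Sum>k\<le>n. c k * b ^ k) \<Longrightarrow>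
    \<exists>x. a < x \<and> x < b \<and> (\<Sum>k\<le>n. c k * x ^ k) = 0"

section \<open>Rolle's theorem, sign changes and root bounds\<close>

lemma poly_ivt:
  fixes p :: "'a::real_closed_field poly"
  assumes "a < b" "poly p a * poly p b < 0"
  obtains x where "a < x" "x < b" "poly p x = 0"
proof -
  have *: "\<exists>x. a < x \<and> x < b \<and> poly q x = 0" if "poly q a < 0" "0 < poly q b" for q :: "'a poly"
    using sum_powers_ivt[OF assms(1), of "coeff q" "degree q"] that by (simp add: poly_altdef)
  show thesis
    using *[of p] *[of "- p"] assms(2) that by (force simp: mult_less_0_iff)
qed

lemma poly_sgn_eq_if_no_root:
  fixes p :: "'a::real_closed_field poly"
  assumes "a \<le> b" "\<And>x. a \<le> x \<Longrightarrow> x \<le> b \<Longrightarrow> poly p x \<noteq> 0"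
  shows "sgn (poly p a) = sgn (poly p b)"
proof (cases "a = b")
  case False
  then have "a < b" using assms by simp
  then have "\<not> poly p a * poly p b < 0"
    using poly_ivt[of a b p] assms(2) by (metis less_imp_le)
  moreover have "poly p a \<noteq> 0" "poly p b \<noteq> 0"
    using assms by auto
  ultimately show ?thesis
    by (auto simp: mult_less_0_iff sgn_if)
qed auto

text \<open>Let \<open>w\<close> be the next root after \<open>u\<close>, and split off both roots
  with their multiplicities. The cofactor \<open>g\<close> keeps its sign on the interval. What
  remains of the derivative is \<open>h\<close>, where \<open>h(u)\<close> is a positive multiple of
  \<open>(u - w) * g(u)\<close> and \<open>h(w)\<close> one of \<open>(w - u) * g(w)\<close>, so
  \<open>h\<close> changes sign.\<close>

lemma poly_rolle:
  fixes p :: "'a::real_closed_field poly"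
  assumes "u < v" "poly p u = 0" "poly p v = 0"
  obtains x where "u < x" "x < v" "poly (pderiv p) x = 0"
proof (cases "p = 0")
  case True
  then show thesis
    using that dense[OF \<open>u < v\<close>] by auto
next
  case False
  define S where "S = {x. u < x \<and> poly p x = 0}"
  have "finite S"
    by (rule finite_subset[OF _ poly_roots_finite[OF False]]) (auto simp: S_def)
  moreover have "v \<in> S" using assms by (auto simp: S_def)
  ultimately have w: "Min S \<in> S" "Min S \<le> v" and min: "\<And>x. x \<in> S \<Longrightarrow> Min S \<le> x"
    by (auto intro: Min_in)
  define w where "w = Min S"
  have uw: "u < w" "poly p w = 0" "w \<le> v" and nr: "\<And>x. u < x \<Longrightarrow> x < w \<Longrightarrow> poly p x \<noteq> 0"
    using w min by (force simp: S_def w_def)+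
  obtain q where q: "p = [:- u, 1:] ^ order u p * q" "\<not> [:- u, 1:] dvd q"
    using order_decomp[OF False] by blast
  have qu: "poly q u \<noteq> 0" using q(2) by (simp add: poly_eq_0_iff_dvd)
  then have "q \<noteq> 0" by auto
  then obtain g where g: "q = [:- w, 1:] ^ order w q * g" "\<not> [:- w, 1:] dvd g"
    using order_decomp by blast
  have gw: "poly g w \<noteq> 0" using g(2) by (simp add: poly_eq_0_iff_dvd)
  have gu: "poly g u \<noteq> 0" using qu g(1) by (metis mult_zero_right poly_mult)
  have "order u p \<noteq> 0" using False assms by (simp add: order_root)
  then obtain m where m: "order u p = Suc m" by (cases "order u p") auto
  have "poly q w = 0"
    using uw(1,2) by (subst (asm) q(1)) auto
  then have "order w q \<noteq> 0" using \<open>q \<noteq> 0\<close> by (simp add: order_root)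
  then obtain n where n: "order w q = Suc n" by (cases "order w q") auto
  have p: "p = [:- u, 1:] ^ Suc m * ([:- w, 1:] ^ Suc n * g)"
    using q(1) g(1) m n by simp
  define h where "h = of_nat (Suc m) * ([:- w, 1:] * g) + of_nat (Suc n) * ([:- u, 1:] * g)
     + [:- u, 1:] * [:- w, 1:] * pderiv g"
  have smult: "smult (of_nat k) q = of_nat k * q" for k and q :: "'a poly"
    by (simp add: of_nat_poly)
  have *: "pderiv (a ^ Suc m * (b ^ Suc n * g)) =
      a ^ m * b ^ n * (of_nat (Suc m) * (b * g) + of_nat (Suc n) * (a * g) + a * b * pderiv g)"
    if "pderiv a = 1" "pderiv b = 1" for a b
    unfolding pderiv_mult pderiv_power_Suc that smult by (simp add: algebra_simps)
  have dp: "pderiv p = [:- u, 1:] ^ m * [:- w, 1:] ^ n * h"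
    unfolding p h_def by (rule *) (simp_all add: pderiv_pCons one_pCons)
  have "\<not> poly g u * poly g w < 0"
  proof
    assume "poly g u * poly g w < 0"
    then obtain x where "u < x" "x < w" "poly g x = 0"
      using poly_ivt uw(1) by blast
    then show False using nr[of x] p by auto
  qed
  then have pos: "poly g u * poly g w > 0"
    using gw gu by (meson linorder_neqE_linordered_idom mult_eq_0_iff)
  have hu: "poly h u = of_nat (Suc m) * (u - w) * poly g u"
    and hw: "poly h w = of_nat (Suc n) * (w - u) * poly g w"
    by (simp_all add: h_def poly_of_nat algebra_simps del: of_nat_Suc)
  have "poly h u * poly h w = - (of_nat (Suc m) * of_nat (Suc n) * (w - u)\<^sup>2 * (poly g u * poly g w))"
    unfolding hu hw by (simp add: power2_eq_square algebra_simps del: of_nat_Suc)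
  also have "\<dots> < 0"
    using pos uw by (simp del: of_nat_Suc)
  finally obtain x where "u < x" "x < w" "poly h x = 0"
    using poly_ivt uw(1) by blast
  then show thesis
    using that[of x] dp uw by auto
qed

lemma poly_root_unique:
  fixes p :: "'a::real_closed_field poly"
  assumes nr: "\<And>t. u < t \<Longrightarrow> t < v \<Longrightarrow> poly (pderiv p) t \<noteq> 0"
    and "u \<le> x" "x \<le> v" "poly p x = 0" "u \<le> y" "y \<le> v" "poly p y = 0"
  shows "x = y"
proof (rule ccontr)
  assume "x \<noteq> y"
  then consider "x < y" | "y < x" by fastforce
  then show False
    using assms poly_rolle[of x y p] poly_rolle[of y x p]
    by (metis le_less_trans less_le_trans)
qed

text \<open>The root is simple, and the cofactor \<open>p / (t - x)\<close> has no root in \<open>[u, v]\<close>.\<close>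

lemma poly_sign_change_if_root:
  fixes p :: "'a::real_closed_field poly"
  assumes nr: "\<And>t. u < t \<Longrightarrow> t < v \<Longrightarrow> poly (pderiv p) t \<noteq> 0"
    and x: "u < x" "x < v" "poly p x = 0"
  shows "poly p u * poly p v < 0"
proof -
  obtain g where g: "p = [:- x, 1:] * g"
    using x(3) by (auto simp: poly_eq_0_iff_dvd)
  have "poly (pderiv p) x = poly g x"
    unfolding g pderiv_mult by (simp add: pderiv_pCons)
  then have gx: "poly g x \<noteq> 0" using nr x by metis
  have "poly g t \<noteq> 0" if "u \<le> t" "t \<le> v" for t
  proof
    assume "poly g t = 0"
    then have "poly p t = 0" by (simp add: g)
    then have "t = x"
      using poly_root_unique[of u v p t x] nr that x by auto
    then show False using gx \<open>poly g t = 0\<close> by simp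
  qed
  then have "sgn (poly g u) = sgn (poly g v)" and nz: "poly g u \<noteq> 0"
    using poly_sgn_eq_if_no_root[of u v g] x by auto
  then have "poly g u * poly g v > 0"
    by (metis linorder_neqE_linordered_idom mult_less_0_iff sgn_eq_0_iff sgn_greater sgn_less zero_less_mult_iff)
  then have "(x - u) * (v - x) * (poly g u * poly g v) > 0"
    using x by simp
  moreover have "poly p u * poly p v = - ((x - u) * (v - x) * (poly g u * poly g v))"
    by (simp add: g algebra_simps)
  ultimately show ?thesis by simp
qed

text \<open>If \<open>1 \<le> \<bar>x\<bar>\<close>, solve for the leading term and bound every
  lower power by the power \<open>degree p - 1\<close>. Admitting any upper bounds
  \<open>M i\<close> of the coefficient ratios makes room for bounds written without absolute
  values.\<close>

lemma poly_root_bound: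
  fixes p :: "'a::linordered_field poly"
  assumes "degree p > 0" "\<And>i. i < degree p \<Longrightarrow> \<bar>coeff p i\<bar> \<le> M i * \<bar>lead_coeff p\<bar>"
    and x: "poly p x = 0"
  shows "\<bar>x\<bar> < 1 + (\<Sum>i<degree p. M i)"
proof -
  define n where "n = degree p"
  define l where "l = lead_coeff p"
  have l: "\<bar>l\<bar> > 0" using assms(1) by (auto simp: l_def)
  have M: "M i \<ge> 0" if "i < n" for i
  proof -
    have "0 \<le> M i * \<bar>l\<bar>" using assms(2)[of i] that unfolding n_def l_def by (meson abs_ge_zero order_trans)
    then show ?thesis using l by (simp add: zero_le_mult_iff)
  qed
  show ?thesis
  proof (cases "\<bar>x\<bar> < 1")
    case True
    have "(\<Sum>i<n. M i) \<ge> 0" by (intro sum_nonneg) (use M in auto)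
    then show ?thesis using True unfolding n_def by linarith
  next
    case False
    then have x1: "\<bar>x\<bar> \<ge> 1" by simp
    have "poly p x = (\<Sum>i<n. coeff p i * x ^ i) + l * x ^ n"
      unfolding poly_altdef n_def l_def by (simp flip: lessThan_Suc_atMost)
    then have "l * x ^ n = - (\<Sum>i<n. coeff p i * x ^ i)"
      using x by (simp add: eq_neg_iff_add_eq_0 add.commute)
    then have "\<bar>l\<bar> * \<bar>x\<bar> ^ n = \<bar>\<Sum>i<n. coeff p i * x ^ i\<bar>"
      by (metis abs_minus_cancel abs_mult power_abs)
    also have "\<dots> \<le> (\<Sum>i<n. \<bar>coeff p i * x ^ i\<bar>)" by (rule sum_abs)
    also have "\<dots> \<le> (\<Sum>i<n. M i * \<bar>l\<bar> * \<bar>x\<bar> ^ (n - 1))"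
    proof (rule sum_mono)
      fix i assume i: "i \<in> {..<n}"
      have "\<bar>x\<bar> ^ i \<le> \<bar>x\<bar> ^ (n - 1)" using i x1 by (intro power_increasing) auto
      then show "\<bar>coeff p i * x ^ i\<bar> \<le> M i * \<bar>l\<bar> * \<bar>x\<bar> ^ (n - 1)"
        using assms(2)[of i] i M unfolding abs_mult power_abs n_def l_def by (intro mult_mono) auto
    qed
    also have "\<dots> = \<bar>l\<bar> * ((\<Sum>i<n. M i) * \<bar>x\<bar> ^ (n - 1))"
      by (simp add: sum_distrib_right sum_distrib_left algebra_simps)
    finally have "\<bar>x\<bar> ^ n \<le> (\<Sum>i<n. M i) * \<bar>x\<bar> ^ (n - 1)"
      using l by simp
    moreover have "\<bar>x\<bar> ^ n = \<bar>x\<bar> * \<bar>x\<bar> ^ (n - 1)"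
      using assms(1) by (simp add: n_def power_eq_if)
    ultimately have "\<bar>x\<bar> \<le> (\<Sum>i<n. M i)"
      using x1 by (metis mult_le_cancel_right_pos less_le_trans zero_less_one zero_less_power)
    then show ?thesis unfolding n_def by simp
  qed
qed

instance real :: real_closed_field
proof
  fix a b :: real and c :: "nat \<Rightarrow> real" and n :: nat
  assume "a < b" and ab: "(\<Sum>k\<le>n. c k * a ^ k) < 0" "0 < (\<Sum>k\<le>n. c k * b ^ k)"
  have "\<exists>x\<ge>a. x \<le> b \<and> (\<Sum>k\<le>n. c k * x ^ k) = 0"
    using ab \<open>a < b\<close> by (intro IVT') (auto intro!: continuous_intros)
  then show "\<exists>x. a < x \<and> x < b \<and> (\<Sum>k\<le>n. c k * x ^ k) = 0"
    using ab by (metis less_irrefl order_less_le)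
qed

text \<open>Integer-valued, so that signs in two different ordered fields can be equated.\<close>

definition isgn :: "'a::linordered_field \<Rightarrow> int" where
  "isgn x = (if x > 0 then 1 else if x < 0 then -1 else 0)"

lemma isgn_0 [simp]: "isgn 0 = 0" and isgn_eq_0_iff [simp]: "isgn x = 0 \<longleftrightarrow> x = 0"
  and isgn_eq_1_iff: "isgn x = 1 \<longleftrightarrow> x > 0"
  by (auto simp: isgn_def)

lemma isgn_mult: "isgn (x * y) = isgn x * isgn y"
  by (auto simp: isgn_def mult_less_0_iff zero_less_mult_iff)

lemma isgn_power: "isgn (x ^ n) = isgn x ^ n"
  by (induction n) (auto simp: isgn_mult, simp add: isgn_def)

lemma isgn_eq_if_no_root:
  fixes p :: "'a::real_closed_field poly"
  assumes "a \<le> b" "\<And>x. a \<le> x \<Longrightarrow> x \<le> b \<Longrightarrow> poly p x \<noteq> 0"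
  shows "isgn (poly p a) = isgn (poly p b)"
  using poly_sgn_eq_if_no_root[OF assms] assms(2)[of a] assms(2)[of b] \<open>a \<le> b\<close>
  by (auto simp: isgn_def sgn_if split: if_splits)

section \<open>Ring homomorphisms and subrings\<close>

definition ring_homo :: "('a::comm_ring_1 \<Rightarrow> 'b::comm_ring_1) \<Rightarrow> bool" where
  "ring_homo h \<longleftrightarrow> h 1 = 1 \<and> (\<forall>a b. h (a + b) = h a + h b) \<and> (\<forall>a b. h (a * b) = h a * h b)"

context
  fixes h :: "'a::comm_ring_1 \<Rightarrow> 'b::comm_ring_1"
  assumes h: "ring_homo h"
begin

lemma homo_1: "h 1 = 1" and homo_add: "h (a + b) = h a + h b" and homo_mult: "h (a * b) = h a * h b"
  using h by (auto simp: ring_homo_def)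

lemma homo_0: "h 0 = 0"
  using homo_add[of 0 0] by simp

lemma homo_uminus: "h (- a) = - h a"
  using homo_add[of a "- a"] by (simp add: homo_0 add_eq_0_iff2)

lemma homo_diff: "h (a - b) = h a - h b"
  using homo_add[of a "- b"] by (simp add: homo_uminus)

lemma homo_power: "h (a ^ n) = h a ^ n"
  by (induction n) (auto simp: homo_1 homo_mult)

lemma homo_sum: "h (sum f A) = (\<Sum>x\<in>A. h (f x))"
  by (induction A rule: infinite_finite_induct) (auto simp: homo_0 homo_add)

lemma homo_prod: "h (prod f A) = (\<Prod>x\<in>A. h (f x))"
  by (induction A rule: infinite_finite_induct) (auto simp: homo_1 homo_mult)

lemma homo_sum_list: "h (sum_list xs) = sum_list (map h xs)"
  by (induction xs) (auto simp: homo_0 homo_add)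

lemma homo_of_nat: "h (of_nat n) = of_nat n"
  by (induction n) (auto simp: homo_0 homo_1 homo_add)

lemma coeff_map_homo: "coeff (map_poly h p) n = h (coeff p n)"
  by (rule coeff_map_poly) (rule homo_0)

lemma map_poly_homo: "ring_homo (map_poly h)"
  unfolding ring_homo_def
  by (auto intro!: poly_eqI simp: coeff_map_homo homo_add homo_mult homo_sum coeff_mult homo_1 homo_0
    coeff_1 split: if_splits)

lemma map_poly_homo_pCons: "map_poly h (pCons a p) = pCons (h a) (map_poly h p)"
  by (rule map_poly_pCons) (rule homo_0)

lemma map_poly_homo_smult: "map_poly h (smult c p) = smult (h c) (map_poly h p)"
  by (rule poly_eqI) (simp add: coeff_map_homo homo_mult)

lemma poly_map_homo: "poly (map_poly h p) (h x) = h (poly p x)"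
  by (induction p) (auto simp: homo_0 map_poly_homo_pCons homo_add homo_mult)

lemma degree_map_homo_le: "degree (map_poly h p) \<le> degree p"
  by (rule degree_le) (auto simp: coeff_map_homo coeff_eq_0 homo_0)

lemma degree_map_homo: "h (lead_coeff p) \<noteq> 0 \<Longrightarrow> degree (map_poly h p) = degree p"
  by (metis coeff_map_homo degree_map_homo_le le_antisym le_degree)

end

section \<open>Subrings and polynomials with coefficients in them\<close>

definition subring_set :: "'a::comm_ring_1 set \<Rightarrow> bool" where
  "subring_set S \<longleftrightarrow> 1 \<in> S \<and> (\<forall>a\<in>S. \<forall>b\<in>S. a - b \<in> S \<and> a * b \<in> S)"

definition polys_over :: "'a::zero set \<Rightarrow> 'a poly set" where
  "polys_over S = {p. \<forall>i. coeff p i \<in> S}"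

context
  fixes S :: "'a::comm_ring_1 set"
  assumes S: "subring_set S"
begin

lemma subring_1: "1 \<in> S" and subring_diff: "a \<in> S \<Longrightarrow> b \<in> S \<Longrightarrow> a - b \<in> S"
  and subring_mult: "a \<in> S \<Longrightarrow> b \<in> S \<Longrightarrow> a * b \<in> S"
  using S by (auto simp: subring_set_def)

lemma subring_0: "0 \<in> S"
  using subring_diff[OF subring_1 subring_1] by simp

lemma subring_uminus: "a \<in> S \<Longrightarrow> - a \<in> S"
  using subring_diff[OF subring_0] by simp

lemma subring_add: "a \<in> S \<Longrightarrow> b \<in> S \<Longrightarrow> a + b \<in> S"
  using subring_diff[of a "- b"] subring_uminus by simp

lemma subring_power: "a \<in> S \<Longrightarrow> a ^ n \<in> S"
  by (induction n) (auto intro: subring_1 subring_mult)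

lemma subring_sum: "(\<And>x. x \<in> A \<Longrightarrow> f x \<in> S) \<Longrightarrow> sum f A \<in> S"
  by (induction A rule: infinite_finite_induct) (auto intro: subring_0 subring_add)

lemma subring_of_nat: "of_nat n \<in> S"
  by (induction n) (auto intro: subring_0 subring_1 subring_add)

lemmas subring_intros = subring_0 subring_1 subring_diff subring_mult subring_uminus subring_add
  subring_power subring_of_nat

end

lemma subring_polys_over:
  assumes "subring_set S"
  shows "subring_set (polys_over S)"
  unfolding subring_set_def polys_over_def
  by (auto simp: coeff_1 coeff_mult intro!: subring_intros[OF assms] subring_sum[OF assms])

context
  fixes S :: "'a::comm_ring_1 set"
  assumes S: "subring_set S"
begin

lemma smult_polys_over: "c \<in> S \<Longrightarrow> p \<in> polys_over S \<Longrightarrow> smult c p \<in> polys_over S"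
  by (auto simp: polys_over_def intro: subring_mult[OF S])

lemma monom_polys_over: "c \<in> S \<Longrightarrow> monom c n \<in> polys_over S"
  by (auto simp: polys_over_def intro: subring_0[OF S])

lemma pCons_polys_over: "c \<in> S \<Longrightarrow> p \<in> polys_over S \<Longrightarrow> pCons c p \<in> polys_over S"
  by (auto simp: polys_over_def coeff_pCons split: nat.split)

lemma reflect_polys_over: "p \<in> polys_over S \<Longrightarrow> reflect_poly p \<in> polys_over S"
  by (auto simp: polys_over_def coeff_reflect_poly intro: subring_0[OF S])

lemma poly_polys_over: "p \<in> polys_over S \<Longrightarrow> x \<in> S \<Longrightarrow> poly p x \<in> S"
  unfolding poly_altdef polys_over_def by (intro subring_sum[OF S] subring_mult[OF S] subring_power[OF S]) auto

text \<open>The leading coefficient of \<open>p\<close> need not be invertible in \<open>S\<close>,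
  so \<open>q\<close> is multiplied by a power of it instead. Each round cancels the top coefficient
  of \<open>q\<close>.\<close>

lemma pseudo_division_polys_over:
  assumes p: "p \<in> polys_over S" "degree p > 0" and "q \<in> polys_over S"
  shows "\<exists>k s r. s \<in> polys_over S \<and> r \<in> polys_over S \<and>
    smult (lead_coeff p ^ k) q = p * s + r \<and> degree r < degree p"
  using assms(3)
proof (induction "degree q" arbitrary: q rule: less_induct)
  case less
  note P = subring_polys_over[OF S]
  define l where "l = lead_coeff p"
  have l: "l \<in> S" using p by (auto simp: l_def polys_over_def)
  show ?case
  proof (cases "degree q < degree p")
    case True
    then show ?thesis
      using less.prems p by (intro exI[of _ 0] exI[of _ 0] exI[of _ q]) (auto intro: subring_0[OF P])
  next
    case False
    define m where "m = monom (lead_coeff q) (degree q - degree p)"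
    have m: "m \<in> polys_over S"
      unfolding m_def using less.prems by (intro monom_polys_over) (auto simp: polys_over_def)
    define q1 where "q1 = smult l q - m * p"
    have q1: "q1 \<in> polys_over S"
      unfolding q1_def by (intro subring_diff[OF P] subring_mult[OF P] smult_polys_over l m p less.prems)
    have "coeff q1 i = 0" if "i \<ge> degree q" for i
    proof (cases "i = degree q")
      case True
      then show ?thesis
        using False by (simp add: q1_def m_def coeff_monom_mult l_def)
    next
      case i: False
      then show ?thesis
        using False that by (simp add: q1_def m_def coeff_monom_mult coeff_eq_0)
    qed
    \<comment> \<open>When \<open>q1 = 0\<close> this inequality is still strict, because
      \<open>degree q\<close> is at least \<open>degree p\<close>, which is positive.\<close>
    then have "degree q1 < degree q"
      using False p(2) by (metis gr_implies_not0 leD leading_coeff_0_iff linorder_not_less degree_0 not_gr_zero order_less_le_trans)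
    then obtain k s r where *: "s \<in> polys_over S" "r \<in> polys_over S"
      "smult (l ^ k) q1 = p * s + r" "degree r < degree p"
      using less.hyps[OF _ q1] unfolding l_def by blast
    have "smult (l ^ Suc k) q = p * (s + smult (l ^ k) m) + r"
      using *(3) unfolding q1_def by (simp add: algebra_simps smult_diff_right)
    moreover have "s + smult (l ^ k) m \<in> polys_over S"
      by (intro subring_add[OF P] smult_polys_over * m subring_power[OF S] l)
    ultimately show ?thesis
      using * unfolding l_def by blast
  qed
qed

end

text \<open>\<open>pderiv\<close> is only available over rings without zero divisors.\<close>

definition formal_deriv :: "'a::comm_ring_1 poly \<Rightarrow> 'a poly" where
  "formal_deriv p = (\<Sum>i<degree p. monom (of_nat (Suc i) * coeff p (Suc i)) i)"

lemma coeff_formal_deriv: "coeff (formal_deriv p) n = of_nat (Suc n) * coeff p (Suc n)"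
  by (auto simp: formal_deriv_def coeff_sum coeff_eq_0)

lemma map_poly_formal_deriv:
  fixes h :: "'a::comm_ring_1 \<Rightarrow> 'b::idom"
  assumes "ring_homo h"
  shows "map_poly h (formal_deriv p) = pderiv (map_poly h p)"
  by (rule poly_eqI)
    (simp add: coeff_map_homo[OF assms] coeff_formal_deriv coeff_pderiv homo_mult[OF assms]
      homo_of_nat[OF assms] del: of_nat_Suc)

lemma formal_deriv_polys_over:
  assumes "subring_set S" "p \<in> polys_over S"
  shows "formal_deriv p \<in> polys_over S"
  using assms(2)
  by (auto simp: polys_over_def coeff_formal_deriv intro!: subring_mult subring_of_nat assms(1)
    simp del: of_nat_Suc)

lemma poly_eq_sum_atMost:
  fixes q :: "'a::comm_semiring_1 poly"
  assumes "degree q \<le> n"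
  shows "poly q x = (\<Sum>i\<le>n. coeff q i * x ^ i)"
  unfolding poly_altdef using assms by (intro sum.mono_neutral_left) (auto simp: coeff_eq_0)

text \<open>Reads off the sign at an inverse from the sign of another polynomial at the element
  itself. The exponent is the degree before \<open>h\<close> is applied, since \<open>h\<close> may
  kill the leading coefficient.\<close>

lemma poly_map_reflect:
  fixes h :: "'a::comm_ring_1 \<Rightarrow> 'b::field"
  assumes h: "ring_homo h" and "x \<noteq> 0"
  shows "poly (map_poly h (reflect_poly p)) x = x ^ degree p * poly (map_poly h p) (inverse x)"
proof -
  define n where "n = degree p"
  have "degree (map_poly h (reflect_poly p)) \<le> n"
    unfolding n_def using degree_map_homo_le[OF h] degree_reflect_poly_le order_trans by blast
  then have "poly (map_poly h (reflect_poly p)) x = (\<Sum>i\<le>n. h (coeff p (n - i)) * x ^ i)"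
    by (subst poly_eq_sum_atMost[of _ n])
      (auto intro!: sum.cong simp: coeff_map_homo[OF h] coeff_reflect_poly n_def)
  also have "\<dots> = (\<Sum>i\<le>n. h (coeff p i) * x ^ (n - i))"
    by (rule sum.reindex_bij_witness[of _ "\<lambda>i. n - i" "\<lambda>i. n - i"]) auto
  also have "\<dots> = (\<Sum>i\<le>n. x ^ n * (h (coeff p i) * inverse x ^ i))"
    using \<open>x \<noteq> 0\<close> by (intro sum.cong) (auto simp: power_diff field_simps)
  also have "\<dots> = x ^ n * poly (map_poly h p) (inverse x)"
    using degree_map_homo_le[OF h, of p]
    by (simp add: poly_eq_sum_atMost[of _ n] n_def coeff_map_homo[OF h] sum_distrib_left)
  finally show ?thesis unfolding n_def .
qed

section \<open>Transfer of signs between real closed fields\<close>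

text \<open>The end points of the gap around \<open>x\<close> are returned as elements of
  \<open>Z\<close> rather than as values, so that the same two elements can be evaluated on the
  other side as well.\<close>

lemma neighbours:
  fixes f :: "'a \<Rightarrow> 'b::linorder"
  assumes "finite Z" "x \<notin> f ` Z" "u0 \<in> Z" "f u0 < x" "v0 \<in> Z" "x < f v0"
  obtains u v where "u \<in> Z" "v \<in> Z" "f u < x" "x < f v" "\<And>z. z \<in> Z \<Longrightarrow> \<not> (f u < f z \<and> f z < f v)"
proof -
  define L U where "L = f ` {z\<in>Z. f z < x}" and "U = f ` {z\<in>Z. x < f z}"
  have fin: "finite L" "finite U" and ne: "L \<noteq> {}" "U \<noteq> {}"
    using assms by (auto simp: L_def U_def)
  obtain u v where u: "u \<in> Z" "f u < x" "f u = Max L" and v: "v \<in> Z" "x < f v" "f v = Min U"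
    using Max_in[OF fin(1) ne(1)] Min_in[OF fin(2) ne(2)] unfolding L_def U_def by auto
  show thesis
  proof (rule that[OF u(1) v(1) u(2) v(2)])
    fix z assume "z \<in> Z"
    then consider "f z < x" | "x < f z" using assms(2) by (metis imageI linorder_neqE)
    then show "\<not> (f u < f z \<and> f z < f v)"
    proof cases
      case 1
      then have "f z \<le> Max L" using fin \<open>z \<in> Z\<close> by (intro Max_ge) (auto simp: L_def)
      then show ?thesis using u by auto
    next
      case 2
      then have "Min U \<le> f z" using fin \<open>z \<in> Z\<close> by (intro Min_le) (auto simp: U_def)
      then show ?thesis using v by auto
    qed
  qed
qed

lemma isgn_eq_between_no_root:
  fixes q :: "'a::real_closed_field poly"
  assumes "\<And>x. c < x \<Longrightarrow> x < d \<Longrightarrow> poly q x \<noteq> 0" "c < s" "s < d" "c < t" "t < d"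
  shows "isgn (poly q s) = isgn (poly q t)"
proof (cases "s \<le> t")
  case True
  then show ?thesis
    by (rule isgn_eq_if_no_root) (use assms in auto)
next
  case False
  then have "t \<le> s" by simp
  then show ?thesis
    by (rule isgn_eq_if_no_root[symmetric]) (use assms in auto)
qed

lemma isgn_eq_imp_neg_iff: "isgn a = isgn b \<Longrightarrow> a < 0 \<longleftrightarrow> b < 0"
  by (auto simp: isgn_def split: if_splits)

text \<open>The bound is a ring expression in the coefficients and \<open>m\<close>, so that one
  element bounds the roots under every suitable homomorphism. Absolute values are avoided through
  \<open>\<bar>t\<bar> \<le> t * t + 1\<close>.\<close>

lemma homo_root_bound:
  fixes h :: "'b::comm_ring_1 \<Rightarrow> 'c::linordered_field"
  assumes h: "ring_homo h" and l: "h (lead_coeff p) \<noteq> 0" and m: "h m = inverse (h (lead_coeff p))"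
    and p: "degree p > 0" and x: "poly (map_poly h p) x = 0"
  shows "\<bar>x\<bar> < h (1 + (\<Sum>i<degree p. (coeff p i * m)\<^sup>2 + 1))"
proof -
  define M where "M i = (h (coeff p i) * h m)\<^sup>2 + 1" for i
  have deg: "degree (map_poly h p) = degree p"
    by (rule degree_map_homo[OF h l])
  have "\<bar>x\<bar> < 1 + (\<Sum>i<degree (map_poly h p). M i)"
  proof (rule poly_root_bound)
    fix i
    define t where "t = h (coeff p i) * h m"
    have "\<bar>t\<bar> \<le> t\<^sup>2 + 1"
    proof -
      have "0 \<le> (\<bar>t\<bar> - 1)\<^sup>2" by simp
      then have "2 * \<bar>t\<bar> \<le> t\<^sup>2 + 1" by (simp add: power2_diff)
      then show ?thesis using abs_ge_zero[of t] by linarith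
    qed
    then have "\<bar>t\<bar> * \<bar>h (lead_coeff p)\<bar> \<le> M i * \<bar>h (lead_coeff p)\<bar>"
      unfolding M_def t_def[symmetric] by (intro mult_right_mono) auto
    moreover have "\<bar>t\<bar> * \<bar>h (lead_coeff p)\<bar> = \<bar>h (coeff p i)\<bar>"
      using l m by (simp add: t_def abs_mult[symmetric] mult.assoc)
    ultimately show "\<bar>coeff (map_poly h p) i\<bar> \<le> M i * \<bar>lead_coeff (map_poly h p)\<bar>"
      by (simp add: coeff_map_homo[OF h] deg)
  qed (use p x deg in auto)
  then show ?thesis
    by (simp add: deg M_def homo_add[OF h] homo_1[OF h] homo_sum[OF h] homo_power[OF h] homo_mult[OF h])
qed

text \<open>An element \<open>b\<close> stands for the pair of \<open>\<pi> b \<in> K\<close> and the function \<open>y \<mapsto> ev y b\<close>.\<close>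

locale sign_preserving_pairs =
  fixes \<pi> :: "'b::comm_ring_1 \<Rightarrow> 'k::real_closed_field"
    and ev :: "'y \<Rightarrow> 'b \<Rightarrow> 'r::real_closed_field"
    and \<Phi> :: "'y filter" and \<Theta> :: "'b set"
  assumes hom: "ring_homo \<pi>" "\<And>y. ring_homo (ev y)"
    and realize: "\<And>a \<rho>. \<exists>b. \<pi> b = a \<and> (\<forall>y. ev y b = \<rho> y)"
    and subring: "subring_set \<Theta>"
    and sign: "\<And>b. b \<in> \<Theta> \<Longrightarrow> \<forall>\<^sub>F y in \<Phi>. isgn (ev y b) = isgn (\<pi> b)"
    and maximal: "\<And>\<Theta>'. subring_set \<Theta>' \<Longrightarrow> \<Theta> \<subseteq> \<Theta>' \<Longrightarrow>
      (\<And>b. b \<in> \<Theta>' \<Longrightarrow> \<forall>\<^sub>F y in \<Phi>. isgn (ev y b) = isgn (\<pi> b)) \<Longrightarrow> \<Theta>' \<subseteq> \<Theta>"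
begin

abbreviation polK :: "'b poly \<Rightarrow> 'k poly" where "polK \<equiv> map_poly \<pi>"
abbreviation polR :: "'y \<Rightarrow> 'b poly \<Rightarrow> 'r poly" where "polR y \<equiv> map_poly (ev y)"
abbreviation Pol :: "'b poly set" where "Pol \<equiv> polys_over \<Theta>"

lemmas in_\<Theta> = subring_intros[OF subring]
lemmas in_Pol = subring_intros[OF subring_polys_over[OF subring]]

lemma sign_poly:
  assumes "p \<in> Pol" "z \<in> \<Theta>"
  shows "\<forall>\<^sub>F y in \<Phi>. isgn (poly (polR y p) (ev y z)) = isgn (poly (polK p) (\<pi> z))"
  using sign[OF poly_polys_over[OF subring assms]]
  by (simp add: poly_map_homo[OF hom(1)] poly_map_homo[OF hom(2)])

lemma sign_less:
  assumes "a \<in> \<Theta>" "b \<in> \<Theta>"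
  shows "\<forall>\<^sub>F y in \<Phi>. ev y a < ev y b \<longleftrightarrow> \<pi> a < \<pi> b"
  using sign[OF in_\<Theta>(3)[OF assms(2,1)]]
proof eventually_elim
  case (elim y)
  then show ?case
    using isgn_eq_1_iff[of "\<pi> b - \<pi> a"] isgn_eq_1_iff[of "ev y b - ev y a"]
    by (simp add: homo_diff[OF hom(1)] homo_diff[OF hom(2)])
qed

lemma sign_less_finite:
  assumes "finite Z" "Z \<subseteq> \<Theta>"
  shows "\<forall>\<^sub>F y in \<Phi>. \<forall>a\<in>Z. \<forall>b\<in>Z. ev y a < ev y b \<longleftrightarrow> \<pi> a < \<pi> b"
  using assms by (intro eventually_ball_finite ballI sign_less) auto

text \<open>The values at \<open>b\<close> of the polynomials over \<open>\<Theta>\<close> form a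
  ring, which by assumption still preserves signs, so maximality applies.\<close>

lemma adjoin:
  assumes "\<And>q. q \<in> Pol \<Longrightarrow>
    \<forall>\<^sub>F y in \<Phi>. isgn (poly (polR y q) (ev y b)) = isgn (poly (polK q) (\<pi> b))"
  shows "b \<in> \<Theta>"
proof -
  define \<Theta>' where "\<Theta>' = (\<lambda>q. poly q b) ` Pol"
  have "subring_set \<Theta>'"
    unfolding subring_set_def \<Theta>'_def
  proof (intro conjI ballI; (elim imageE)?; hypsubst?)
    show "1 \<in> (\<lambda>q. poly q b) ` Pol"
      by (rule image_eqI[of _ _ 1]) (auto intro: in_Pol)
    fix p q assume pq: "p \<in> Pol" "q \<in> Pol"
    show "poly p b - poly q b \<in> (\<lambda>q. poly q b) ` Pol"
      by (rule image_eqI[of _ _ "p - q"]) (use pq in_Pol(3) in auto)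
    show "poly p b * poly q b \<in> (\<lambda>q. poly q b) ` Pol"
      by (rule image_eqI[of _ _ "p * q"]) (use pq in_Pol(4) in auto)
  qed
  moreover have "\<Theta> \<subseteq> \<Theta>'"
  proof
    fix a assume "a \<in> \<Theta>"
    then show "a \<in> \<Theta>'" unfolding \<Theta>'_def
      by (intro image_eqI[of _ _ "[:a:]"] pCons_polys_over[OF subring] in_Pol) auto
  qed
  moreover have "\<forall>\<^sub>F y in \<Phi>. isgn (ev y x) = isgn (\<pi> x)" if "x \<in> \<Theta>'" for x
    using that assms unfolding \<Theta>'_def
    by (auto simp: poly_map_homo[OF hom(1)] poly_map_homo[OF hom(2)])
  ultimately have "\<Theta>' \<subseteq> \<Theta>" by (rule maximal)
  moreover have "b \<in> \<Theta>'" unfolding \<Theta>'_def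
    by (intro image_eqI[of _ _ "[:0, 1:]"] pCons_polys_over[OF subring] in_Pol in_\<Theta>) auto
  ultimately show ?thesis by blast
qed

text \<open>The sign of a polynomial at the inverse of \<open>l\<close> is that of its reflection at
  \<open>l\<close>, up to a power of the sign of \<open>l\<close>. Points where \<open>l\<close>
  evaluates to zero are eventually absent.\<close>

lemma inverse_in:
  assumes l: "l \<in> \<Theta>" "\<pi> l \<noteq> 0"
  obtains m where "m \<in> \<Theta>" "\<pi> m = inverse (\<pi> l)" "\<And>y. ev y m = inverse (ev y l)"
proof -
  obtain m where m: "\<pi> m = inverse (\<pi> l)" "\<And>y. ev y m = inverse (ev y l)"
    using realize[of "inverse (\<pi> l)" "\<lambda>y. inverse (ev y l)"] by blast
  have "m \<in> \<Theta>"
  proof (rule adjoin)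
    fix q assume q: "q \<in> Pol"
    define n where "n = degree q"
    from sign[OF l(1)] sign_poly[OF reflect_polys_over[OF subring q] l(1)]
    show "\<forall>\<^sub>F y in \<Phi>. isgn (poly (polR y q) (ev y m)) = isgn (poly (polK q) (\<pi> m))"
    proof eventually_elim
      case (elim y)
      then have "ev y l \<noteq> 0" using l(2) isgn_eq_0_iff[of "ev y l"] by auto
      then have "isgn (ev y l) ^ n * isgn (poly (polR y q) (ev y m)) =
          isgn (\<pi> l) ^ n * isgn (poly (polK q) (\<pi> m))"
        using elim(2) l(2)
        by (simp add: poly_map_reflect[OF hom(1)] poly_map_reflect[OF hom(2)] isgn_mult isgn_power m n_def)
      then show ?case using elim(1) l(2) by simp
    qed
  qed
  then show thesis using that m by blast
qed

lemma midpoint_in: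
  assumes "a \<in> \<Theta>" "b \<in> \<Theta>"
  obtains m where "m \<in> \<Theta>" "\<pi> m = (\<pi> a + \<pi> b) / 2" "\<And>y. ev y m = (ev y a + ev y b) / 2"
proof -
  define t :: 'b where "t = 1 + 1"
  have t: "t \<in> \<Theta>" "\<pi> t = 2" "\<And>y. ev y t = 2"
    unfolding t_def homo_add[OF hom(1)] homo_1[OF hom(1)] homo_add[OF hom(2)] homo_1[OF hom(2)]
    by (intro in_\<Theta>) simp_all
  obtain h where h: "h \<in> \<Theta>" "\<pi> h = inverse 2" "\<And>y. ev y h = inverse 2"
    using inverse_in[of t] t by auto
  show thesis
    by (rule that[of "(a + b) * h"])
      (auto intro!: in_\<Theta> assms h simp: h(2,3) homo_add[OF hom(1)] homo_mult[OF hom(1)]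
        homo_add[OF hom(2)] homo_mult[OF hom(2)] field_simps)
qed

text \<open>One finite set serves \<open>K\<close> and the real points simultaneously. Its members
  need not be roots, so interval ends and roots of the derivative may be included.\<close>

definition root_cover :: "'b poly \<Rightarrow> 'b set \<Rightarrow> bool" where
  "root_cover p Z \<longleftrightarrow> finite Z \<and> Z \<subseteq> \<Theta> \<and> (\<forall>x. poly (polK p) x = 0 \<longrightarrow> x \<in> \<pi> ` Z) \<and>
    (\<forall>\<^sub>F y in \<Phi>. \<forall>x. poly (polR y p) x = 0 \<longrightarrow> x \<in> ev y ` Z)"

lemma eventually_zero_poly:
  assumes "p \<in> Pol" "polK p = 0"
  shows "\<forall>\<^sub>F y in \<Phi>. polR y p = 0"
proof -
  have "\<forall>\<^sub>F y in \<Phi>. \<forall>i\<in>{..degree p}. ev y (coeff p i) = 0"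
  proof (intro eventually_ball_finite ballI)
    fix i
    have "\<pi> (coeff p i) = 0" using assms(2) coeff_map_homo[OF hom(1), of p i] by simp
    then show "\<forall>\<^sub>F y in \<Phi>. ev y (coeff p i) = 0"
      using sign[of "coeff p i"] assms(1) by (auto simp: polys_over_def)
  qed auto
  then show ?thesis
  proof eventually_elim
    case (elim y)
    show ?case
    proof (rule poly_eqI)
      fix n
      show "coeff (polR y p) n = coeff 0 n"
        using elim by (cases "n \<le> degree p") (auto simp: coeff_map_homo[OF hom(2)] coeff_eq_0 homo_0[OF hom(2)])
    qed
  qed
qed

text \<open>Pseudo-division takes place over \<open>\<Theta>\<close>, before any evaluation; hence
  the same \<open>k\<close> and \<open>r\<close> work in \<open>K\<close> and at every real
  point.\<close>

lemma remainder_at_root: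
  assumes p: "p \<in> Pol" "degree p > 0" and q: "q \<in> Pol"
  shows "\<exists>k r. r \<in> Pol \<and> degree r < degree p \<and>
    (\<forall>x. poly (polK p) x = 0 \<longrightarrow> \<pi> (lead_coeff p) ^ k * poly (polK q) x = poly (polK r) x) \<and>
    (\<forall>y x. poly (polR y p) x = 0 \<longrightarrow> ev y (lead_coeff p) ^ k * poly (polR y q) x = poly (polR y r) x)"
proof -
  obtain k s r where r: "r \<in> Pol" "degree r < degree p"
    and eq: "smult (lead_coeff p ^ k) q = p * s + r"
    using pseudo_division_polys_over[OF subring p q] by blast
  have *: "h (lead_coeff p) ^ k * poly (map_poly h q) x = poly (map_poly h r) x"
    if h: "ring_homo h" and "poly (map_poly h p) x = 0" for h :: "'b \<Rightarrow> 'c::field" and x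
    using arg_cong[OF eq, of "\<lambda>q. poly (map_poly h q) x"] that(2)
    by (simp add: map_poly_homo_smult[OF h] homo_add[OF map_poly_homo[OF h]]
      homo_mult[OF map_poly_homo[OF h]] homo_power[OF h])
  show ?thesis
    by (intro exI[of _ k] exI[of _ r]) (use r *[OF hom(1)] *[OF hom(2)] in auto)
qed

text \<open>Passing to the pseudo-remainder costs a power of the leading coefficient, whose sign is
  nonzero and eventually the same on both sides, so it cancels.\<close>

lemma isgn_eq_at_root:
  assumes p: "p \<in> Pol" "degree p > 0" "\<pi> (lead_coeff p) \<noteq> 0" and q: "q \<in> Pol"
    and root: "poly (polK p) (\<pi> b) = 0" "\<forall>\<^sub>F y in \<Phi>. poly (polR y p) (ev y b) = 0"
    and small: "\<And>r. r \<in> Pol \<Longrightarrow> degree r < degree p \<Longrightarrow>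
      \<forall>\<^sub>F y in \<Phi>. isgn (poly (polR y r) (ev y b)) = isgn (poly (polK r) (\<pi> b))"
  shows "\<forall>\<^sub>F y in \<Phi>. isgn (poly (polR y q) (ev y b)) = isgn (poly (polK q) (\<pi> b))"
proof -
  obtain k r where r: "r \<in> Pol" "degree r < degree p"
    "\<And>x. poly (polK p) x = 0 \<Longrightarrow> \<pi> (lead_coeff p) ^ k * poly (polK q) x = poly (polK r) x"
    "\<And>y x. poly (polR y p) x = 0 \<Longrightarrow> ev y (lead_coeff p) ^ k * poly (polR y q) x = poly (polR y r) x"
    using remainder_at_root[OF p(1,2) q] by blast
  have "lead_coeff p \<in> \<Theta>" using p(1) by (auto simp: polys_over_def)
  from sign[OF this] small[OF r(1,2)] root(2)
  show ?thesis
  proof eventually_elim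
    case (elim y)
    have "isgn (ev y (lead_coeff p) ^ k * poly (polR y q) (ev y b)) =
        isgn (\<pi> (lead_coeff p) ^ k * poly (polK q) (\<pi> b))"
      unfolding r(3)[OF root(1)] r(4)[OF elim(3)] by (rule elim(2))
    then have "isgn (\<pi> (lead_coeff p)) ^ k * isgn (poly (polR y q) (ev y b)) =
        isgn (\<pi> (lead_coeff p)) ^ k * isgn (poly (polK q) (\<pi> b))"
      unfolding isgn_mult isgn_power elim(1) .
    then show ?case using p(3) by simp
  qed
qed

text \<open>A root of \<open>p\<close> in the gap can be adjoined, since modulo \<open>p\<close> every polynomial reduces to one of
  lower degree, whose roots are known to lie in \<open>\<Theta>\<close>.\<close>

lemma gap:
  assumes IH: "\<And>r. r \<in> Pol \<Longrightarrow> polK r \<noteq> 0 \<Longrightarrow> degree (polK r) < degree p \<Longrightarrow> \<exists>Z. root_cover r Z"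
    and p: "p \<in> Pol" "degree p > 0" "\<pi> (lead_coeff p) \<noteq> 0"
    and z: "z \<in> \<Theta>" "z' \<in> \<Theta>" "\<pi> z < \<pi> z'"
    and nrK: "\<And>x. \<pi> z < x \<Longrightarrow> x < \<pi> z' \<Longrightarrow> poly (pderiv (polK p)) x \<noteq> 0"
    and nrR: "\<forall>\<^sub>F y in \<Phi>. \<forall>x. ev y z < x \<longrightarrow> x < ev y z' \<longrightarrow> poly (pderiv (polR y p)) x \<noteq> 0"
  shows "\<exists>W. finite W \<and> W \<subseteq> \<Theta> \<and>
    (\<forall>x. \<pi> z < x \<longrightarrow> x < \<pi> z' \<longrightarrow> poly (polK p) x = 0 \<longrightarrow> x \<in> \<pi> ` W) \<and>
    (\<forall>\<^sub>F y in \<Phi>. \<forall>x. ev y z < x \<longrightarrow> x < ev y z' \<longrightarrow> poly (polR y p) x = 0 \<longrightarrow> x \<in> ev y ` W)"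
proof -
  have prod: "\<forall>\<^sub>F y in \<Phi>. poly (polR y p) (ev y u) * poly (polR y p) (ev y v) < 0 \<longleftrightarrow>
      poly (polK p) (\<pi> u) * poly (polK p) (\<pi> v) < 0" if "u \<in> \<Theta>" "v \<in> \<Theta>" for u v
    using sign_poly[OF p(1) that(1)] sign_poly[OF p(1) that(2)]
  proof eventually_elim
    case (elim y)
    then show ?case
      by (intro isgn_eq_imp_neg_iff) (simp add: isgn_mult)
  qed
  show ?thesis
  proof (cases "poly (polK p) (\<pi> z) * poly (polK p) (\<pi> z') < 0")
    case False
    \<comment> \<open>The derivative has no zero in between, so a root would force a sign change
      between the ends. There is none in \<open>K\<close>, and hence eventually none at the real
      points.\<close>
    have noR: "\<forall>\<^sub>F y in \<Phi>. \<forall>x. ev y z < x \<longrightarrow> x < ev y z' \<longrightarrow> poly (polR y p) x \<noteq> 0"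
      using nrR prod[OF z(1,2)]
    proof eventually_elim
      case (elim y)
      then show ?case using False poly_sign_change_if_root[of "ev y z" "ev y z'" "polR y p"] by blast
    qed
    show ?thesis
    proof (intro exI[of _ "{}"] conjI)
      show "\<forall>\<^sub>F y in \<Phi>. \<forall>x. ev y z < x \<longrightarrow> x < ev y z' \<longrightarrow> poly (polR y p) x = 0 \<longrightarrow> x \<in> ev y ` {}"
        using noR by eventually_elim blast
      show "\<forall>x. \<pi> z < x \<longrightarrow> x < \<pi> z' \<longrightarrow> poly (polK p) x = 0 \<longrightarrow> x \<in> \<pi> ` {}"
        using False nrK poly_sign_change_if_root[of "\<pi> z" "\<pi> z'" "polK p"] by blast
    qed simp_all
  next
    case True
    obtain a where a: "\<pi> z < a" "a < \<pi> z'" "poly (polK p) a = 0"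
      using poly_ivt[OF z(3) True] by blast
    \<comment> \<open>The choice in \<open>b\<close> below is arbitrary where no root exists; the
      transferred sign change shows that eventually one does.\<close>
    define is_root where "is_root y x \<longleftrightarrow> ev y z < x \<and> x < ev y z' \<and> poly (polR y p) x = 0" for y x
    obtain b where b: "\<pi> b = a" "\<And>y. ev y b = (SOME x. is_root y x)"
      using realize[of a "\<lambda>y. SOME x. is_root y x"] by blast
    have uniqK: "x = a" if "\<pi> z < x" "x < \<pi> z'" "poly (polK p) x = 0" for x
      using poly_root_unique[of "\<pi> z" "\<pi> z'" "polK p" x a] nrK that a by auto
    have b_root: "\<forall>\<^sub>F y in \<Phi>. is_root y (ev y b)"
      using prod[OF z(1,2)] sign_less[OF z(1,2)]
    proof eventually_elim
      case (elim y)
      then obtain x where "is_root y x"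
        using True z(3) poly_ivt[of "ev y z" "ev y z'" "polR y p"] unfolding is_root_def by blast
      then show ?case unfolding b by (rule someI)
    qed
    have uniqR: "\<forall>\<^sub>F y in \<Phi>. \<forall>x. is_root y x \<longrightarrow> x = ev y b"
      using nrR b_root
    proof eventually_elim
      case (elim y)
      show ?case
      proof (intro allI impI)
        fix x assume x: "is_root y x"
        show "x = ev y b"
          by (rule poly_root_unique[of "ev y z" "ev y z'" "polR y p"])
            (use elim x in \<open>auto simp: is_root_def\<close>)
      qed
    qed
    \<comment> \<open>If \<open>a\<close> already comes from some \<open>w\<close> in
      \<open>\<Theta>\<close>, then \<open>w\<close> is eventually a root of \<open>p\<close> in the
      gap and agrees with \<open>b\<close> by uniqueness. Otherwise \<open>a\<close> differs from
      every value of \<open>\<Theta>\<close>, so it lies strictly inside a gap of any finite subset,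
      and \<open>b\<close> itself can be adjoined.\<close>
    have "\<exists>w\<in>\<Theta>. \<pi> w = a \<and> (\<forall>\<^sub>F y in \<Phi>. ev y w = ev y b)"
    proof (cases "a \<in> \<pi> ` \<Theta>")
      case True
      then obtain w where w: "w \<in> \<Theta>" "\<pi> w = a" by auto
      have "\<forall>\<^sub>F y in \<Phi>. ev y w = ev y b"
        using uniqR sign_poly[OF p(1) w(1)] sign_less[OF z(1) w(1)] sign_less[OF w(1) z(2)]
      proof eventually_elim
        case (elim y)
        then have "is_root y (ev y w)" using a w by (simp add: is_root_def)
        then show ?case using elim by simp
      qed
      then show ?thesis using w by blast
    next
      case new: False
      have rootK: "poly (polK p) (\<pi> b) = 0" using a(3) b(1) by simp
      have rootR: "\<forall>\<^sub>F y in \<Phi>. poly (polR y p) (ev y b) = 0"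
        using b_root by eventually_elim (simp add: is_root_def)
      have small: "\<forall>\<^sub>F y in \<Phi>. isgn (poly (polR y r) (ev y b)) = isgn (poly (polK r) (\<pi> b))"
        if r: "r \<in> Pol" "degree r < degree p" for r
      proof (cases "polK r = 0")
        case True
        from eventually_zero_poly[OF r(1) this] show ?thesis
          by eventually_elim (simp add: True)
      next
        case False
        moreover have "degree (polK r) < degree p"
          using r(2) degree_map_homo_le[OF hom(1), of r] by simp
        ultimately obtain Z where Z: "root_cover r Z"
          using IH[OF r(1)] by blast
        \<comment> \<open>Including \<open>z\<close> and \<open>z'\<close> keeps the gap around
          \<open>a\<close> within the interval in which the root of \<open>p\<close> is
          unique.\<close>
        define Z1 where "Z1 = insert z (insert z' Z)"
        have Z1: "finite Z1" "Z1 \<subseteq> \<Theta>" using Z z(1,2) by (simp_all add: Z1_def root_cover_def)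
        have zZ1: "z \<in> Z1" "z' \<in> Z1" by (auto simp: Z1_def)
        have "a \<notin> \<pi> ` Z1" using Z1(2) new by blast
        then obtain u v where uv: "u \<in> Z1" "v \<in> Z1" "\<pi> u < a" "a < \<pi> v"
          and adj: "\<And>t. t \<in> Z1 \<Longrightarrow> \<not> (\<pi> u < \<pi> t \<and> \<pi> t < \<pi> v)"
          using neighbours[OF Z1(1) _ zZ1(1) a(1) zZ1(2) a(2)] by metis
        have uv\<Theta>: "u \<in> \<Theta>" "v \<in> \<Theta>" using uv Z1 by auto
        have zu: "\<pi> z \<le> \<pi> u" "\<pi> v \<le> \<pi> z'"
          using adj[of z] adj[of z'] uv(3,4) a(1,2) by (auto simp: Z1_def not_less)
        obtain m where m: "m \<in> \<Theta>" "\<pi> m = (\<pi> u + \<pi> v) / 2" "\<And>y. ev y m = (ev y u + ev y v) / 2"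
          using midpoint_in[OF uv\<Theta>] by blast
        have noK: "poly (polK r) x \<noteq> 0" if "\<pi> u < x" "x < \<pi> v" for x
          using Z adj that unfolding root_cover_def Z1_def by blast
        have "\<pi> u < \<pi> m" "\<pi> m < \<pi> v" using m(2) uv by (auto simp: field_simps)
        then have K: "isgn (poly (polK r) (\<pi> m)) = isgn (poly (polK r) a)"
          using isgn_eq_between_no_root[of "\<pi> u" "\<pi> v" "polK r"] noK uv by blast
        \<comment> \<open>The sign change of \<open>p\<close> across the narrower gap carries over
          to the real points and locates \<open>b\<close> between \<open>u\<close> and
          \<open>v\<close>. There \<open>r\<close> has no root, so its sign at \<open>b\<close> is
          its sign at the midpoint \<open>m\<close>, an element of \<open>\<Theta>\<close>.\<close>
        have changeK: "poly (polK p) (\<pi> u) * poly (polK p) (\<pi> v) < 0"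
          by (rule poly_sign_change_if_root[OF nrK uv(3,4) a(3)]) (use zu in auto)
        have "\<forall>\<^sub>F y in \<Phi>. \<forall>x. poly (polR y r) x = 0 \<longrightarrow> x \<in> ev y ` Z"
          using Z by (simp add: root_cover_def)
        then show ?thesis
          using sign_less_finite[OF Z1] prod[OF uv\<Theta>] sign_poly[OF r(1) m(1)] uniqR
        proof eventually_elim
          case (elim y)
          have noR: "poly (polR y r) x \<noteq> 0" if "ev y u < x" "x < ev y v" for x
          proof
            assume "poly (polR y r) x = 0"
            then obtain t where "t \<in> Z" "x = ev y t" using elim(1) by blast
            then have t: "t \<in> Z1" "ev y u < ev y t" "ev y t < ev y v"
              using that by (auto simp: Z1_def)
            then have "\<pi> u < \<pi> t" "\<pi> t < \<pi> v" using elim(2) uv(1,2) by simp_all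
            then show False using adj t(1) by blast
          qed
          have uvy: "ev y u < ev y v" using elim(2) uv by simp
          obtain x where x: "ev y u < x" "x < ev y v" "poly (polR y p) x = 0"
            using poly_ivt[OF uvy] elim(3) changeK by blast
          have "\<not> ev y u < ev y z" "\<not> ev y z' < ev y v"
            using elim(2) uv(1,2) zu zZ1 by simp_all
          then have "is_root y x"
            using x unfolding is_root_def by auto
          then have "x = ev y b" using elim(5) by blast
          moreover have "ev y u < ev y m" "ev y m < ev y v" using m(3)[of y] uvy by (auto simp: field_simps)
          ultimately have "isgn (poly (polR y r) (ev y m)) = isgn (poly (polR y r) (ev y b))"
            using isgn_eq_between_no_root[of "ev y u" "ev y v" "polR y r"] noR x by blast
          then show ?case using K elim(4) b(1) by simp
        qed
      qed
      have "b \<in> \<Theta>"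
      proof (rule adjoin)
        fix q assume q: "q \<in> Pol"
        show "\<forall>\<^sub>F y in \<Phi>. isgn (poly (polR y q) (ev y b)) = isgn (poly (polK q) (\<pi> b))"
          by (rule isgn_eq_at_root[OF p q rootK rootR]) (rule small)
      qed
      then show ?thesis using b(1) by (intro bexI[of _ b]) simp_all
    qed
    then obtain w where w: "w \<in> \<Theta>" "\<pi> w = a" "\<forall>\<^sub>F y in \<Phi>. ev y w = ev y b" by blast
    show ?thesis
    proof (intro exI[of _ "{w}"] conjI allI impI)
      show "\<forall>\<^sub>F y in \<Phi>. \<forall>x. ev y z < x \<longrightarrow> x < ev y z' \<longrightarrow> poly (polR y p) x = 0 \<longrightarrow> x \<in> ev y ` {w}"
        using uniqR w(3) by eventually_elim (auto simp: is_root_def)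
      fix x assume "\<pi> z < x" "x < \<pi> z'" "poly (polK p) x = 0"
      then have "x = a" by (rule uniqK)
      then show "x \<in> \<pi> ` {w}" using w(2) by simp
    qed (use w(1) in simp_all)
  qed
qed

text \<open>The covered roots of the derivative, together with two outer bounds, cut the line into
  gaps on which the derivative does not vanish. Each gap is treated by \<open>gap\<close>, and the
  results are united. The induction runs on the degree over \<open>K\<close>, since coefficients may
  vanish there.\<close>

lemma root_cover_exists:
  assumes "p \<in> Pol" "polK p \<noteq> 0"
  shows "\<exists>Z. root_cover p Z"
  using assms
proof (induction "degree (polK p)" arbitrary: p rule: less_induct)
  case less
  \<comment> \<open>\<open>p'\<close> drops the coefficients above \<open>n\<close>. They vanish in
    \<open>K\<close>, hence eventually at the real points, and afterwards the leading coefficient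
    has nonzero image, as \<open>inverse_in\<close> and \<open>gap\<close> require.\<close>
  define n where "n = degree (polK p)"
  define p' where "p' = poly_cutoff (Suc n) p"
  have p': "p' \<in> Pol"
    using less.prems(1) in_\<Theta>(1) by (auto simp: polys_over_def p'_def coeff_poly_cutoff)
  have polK: "polK p' = polK p"
  proof (rule poly_eqI)
    fix i
    have "\<pi> (coeff p i) = 0" if "i > n"
      using that coeff_eq_0[of "polK p" i] by (simp add: n_def coeff_map_homo[OF hom(1)])
    then show "coeff (polK p') i = coeff (polK p) i"
      by (simp add: coeff_map_homo[OF hom(1)] p'_def coeff_poly_cutoff homo_0[OF hom(1)])
  qed
  have "degree p' \<le> n" by (rule degree_le) (auto simp: p'_def coeff_poly_cutoff)
  moreover have "\<pi> (coeff p' n) \<noteq> 0"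
    using less.prems(2) leading_coeff_neq_0[of "polK p'"]
    by (simp add: n_def polK[symmetric] coeff_map_homo[OF hom(1)])
  ultimately have deg: "degree p' = n" and lc: "\<pi> (lead_coeff p') \<noteq> 0"
    using le_degree[of p' n] homo_0[OF hom(1)] by (metis le_antisym)+
  have "polK (p - p') = 0"
    by (simp add: homo_diff[OF map_poly_homo[OF hom(1)]] polK)
  from eventually_zero_poly[OF in_Pol(3)[OF less.prems(1) p'] this]
  have polR: "\<forall>\<^sub>F y in \<Phi>. polR y p = polR y p'"
    by eventually_elim (simp add: homo_diff[OF map_poly_homo[OF hom(2)]])
  have l\<Theta>: "lead_coeff p' \<in> \<Theta>" using p' by (auto simp: polys_over_def)
  from sign[OF this] have lcR: "\<forall>\<^sub>F y in \<Phi>. ev y (lead_coeff p') \<noteq> 0"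
  proof eventually_elim
    case (elim y)
    then show ?case using lc isgn_eq_0_iff[of "\<pi> (lead_coeff p')"] by auto
  qed
  show ?case
  proof (cases "n = 0")
    case True
    have const: "poly (map_poly h p') x = h (lead_coeff p')" if h: "ring_homo h" for h :: "'b \<Rightarrow> 'c::field" and x
    proof -
      have "degree (map_poly h p') = 0" using degree_map_homo_le[OF h, of p'] deg True by simp
      then show ?thesis
        by (simp add: poly_altdef coeff_map_homo[OF h] deg True)
    qed
    have "\<forall>\<^sub>F y in \<Phi>. \<forall>x. poly (polR y p) x = 0 \<longrightarrow> x \<in> ev y ` {}"
      using polR lcR by eventually_elim (simp add: const[OF hom(2)])
    moreover have "poly (polK p) x \<noteq> 0" for x
      using const[OF hom(1), of x] lc polK by simp
    ultimately show ?thesis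
      unfolding root_cover_def by (intro exI[of _ "{}"]) simp
  next
    case False
    then have npos: "degree p' > 0" using deg by simp
    obtain m where m: "m \<in> \<Theta>" "\<pi> m = inverse (\<pi> (lead_coeff p'))" "\<And>y. ev y m = inverse (ev y (lead_coeff p'))"
      using inverse_in[OF l\<Theta> lc] by blast
    \<comment> \<open>This is the bound of \<open>homo_root_bound\<close>. With \<open>- b\<close>
      and \<open>b\<close> among the division points, every root is a division point or lies in a
      bounded gap.\<close>
    define b where "b = 1 + (\<Sum>i<degree p'. (coeff p' i * m)\<^sup>2 + 1)"
    have b: "b \<in> \<Theta>"
      unfolding b_def using p' by (intro in_\<Theta> subring_sum[OF subring] m) (auto simp: polys_over_def)
    have boundK: "\<bar>x\<bar> < \<pi> b" if "poly (polK p') x = 0" for x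
      unfolding b_def by (rule homo_root_bound[OF hom(1) lc m(2) npos that])
    have boundR: "\<bar>x\<bar> < ev y b" if "ev y (lead_coeff p') \<noteq> 0" "poly (polR y p') x = 0" for x y
      unfolding b_def by (rule homo_root_bound[OF hom(2) that(1) m(3) npos that(2)])
    define q where "q = formal_deriv p'"
    have q: "q \<in> Pol" unfolding q_def by (rule formal_deriv_polys_over[OF subring p'])
    have qK: "polK q = pderiv (polK p')" and qR: "polR y q = pderiv (polR y p')" for y
      unfolding q_def by (simp_all add: map_poly_formal_deriv[OF hom(1)] map_poly_formal_deriv[OF hom(2)])
    have "polK q \<noteq> 0" "degree (polK q) < degree (polK p)"
      using False by (simp_all add: qK polK pderiv_eq_0_iff degree_pderiv n_def)
    then obtain Z0 where Z0: "root_cover q Z0"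
      using less.hyps[OF _ q] by blast
    define Z1 where "Z1 = insert b (insert (- b) Z0)"
    have Z1: "finite Z1" "Z1 \<subseteq> \<Theta>"
      using Z0 b in_\<Theta>(5)[OF b] by (simp_all add: Z1_def root_cover_def)
    have bZ1: "b \<in> Z1" "- b \<in> Z1" by (auto simp: Z1_def)
    \<comment> \<open>Adjacency is defined by the order in \<open>K\<close>; eventually it agrees
      with adjacency at the real point, because the order on the finite set \<open>Z1\<close> is
      preserved.\<close>
    define G where "G = {(z, z'). z \<in> Z1 \<and> z' \<in> Z1 \<and> \<pi> z < \<pi> z' \<and> (\<forall>t\<in>Z1. \<not> (\<pi> z < \<pi> t \<and> \<pi> t < \<pi> z'))}"
    have finG: "finite G"
      by (rule finite_subset[of _ "Z1 \<times> Z1"]) (auto simp: G_def Z1)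
    define gap_cover where "gap_cover g W \<longleftrightarrow> finite W \<and> W \<subseteq> \<Theta> \<and>
      (\<forall>x. \<pi> (fst g) < x \<longrightarrow> x < \<pi> (snd g) \<longrightarrow> poly (polK p') x = 0 \<longrightarrow> x \<in> \<pi> ` W) \<and>
      (\<forall>\<^sub>F y in \<Phi>. \<forall>x. ev y (fst g) < x \<longrightarrow> x < ev y (snd g) \<longrightarrow> poly (polR y p') x = 0 \<longrightarrow> x \<in> ev y ` W)"
      for g W
    have "\<exists>W. gap_cover g W" if "g \<in> G" for g
    proof -
      obtain z z' where g: "g = (z, z')" by (cases g)
      have zz: "z \<in> Z1" "z' \<in> Z1" "\<pi> z < \<pi> z'" and adj: "\<And>t. t \<in> Z1 \<Longrightarrow> \<not> (\<pi> z < \<pi> t \<and> \<pi> t < \<pi> z')"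
        using that by (auto simp: G_def g)
      have zz\<Theta>: "z \<in> \<Theta>" "z' \<in> \<Theta>" using zz Z1 by auto
      have nrK: "poly (pderiv (polK p')) x \<noteq> 0" if "\<pi> z < x" "x < \<pi> z'" for x
      proof
        assume "poly (pderiv (polK p')) x = 0"
        then obtain t where "t \<in> Z0" "x = \<pi> t"
          using Z0 unfolding root_cover_def qK by blast
        then show False using adj[of t] that by (simp add: Z1_def)
      qed
      have "\<forall>\<^sub>F y in \<Phi>. \<forall>x. poly (polR y q) x = 0 \<longrightarrow> x \<in> ev y ` Z0"
        using Z0 by (simp add: root_cover_def)
      then have nrR: "\<forall>\<^sub>F y in \<Phi>. \<forall>x. ev y z < x \<longrightarrow> x < ev y z' \<longrightarrow> poly (pderiv (polR y p')) x \<noteq> 0"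
        using sign_less_finite[OF Z1]
      proof eventually_elim
        case (elim y)
        show ?case
        proof (intro allI impI notI)
          fix x assume x: "ev y z < x" "x < ev y z'" "poly (pderiv (polR y p')) x = 0"
          then obtain t where t: "t \<in> Z0" "x = ev y t" using elim(1) unfolding qR by blast
          then have "t \<in> Z1" by (simp add: Z1_def)
          then have "\<pi> z < \<pi> t" "\<pi> t < \<pi> z'" using x(1,2) t elim(2) zz(1,2) by simp_all
          then show False using adj[OF \<open>t \<in> Z1\<close>] by blast
        qed
      qed
      show ?thesis
        unfolding gap_cover_def g fst_conv snd_conv
      proof (rule gap[OF _ p' npos lc zz\<Theta> zz(3) nrK nrR])
        fix r assume "r \<in> Pol" "polK r \<noteq> 0" "degree (polK r) < degree p'"
        then show "\<exists>Z. root_cover r Z"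
          using less.hyps[of r] deg n_def by simp
      qed
    qed
    then obtain W where W: "\<And>g. g \<in> G \<Longrightarrow> gap_cover g (W g)" by metis
    define Z where "Z = Z1 \<union> (\<Union>g\<in>G. W g)"
    have W_sub: "finite (W g)" "W g \<subseteq> \<Theta>" if "g \<in> G" for g
      using W[OF that] by (simp_all add: gap_cover_def)
    have Z: "finite Z" "Z \<subseteq> \<Theta>"
      unfolding Z_def using Z1(1) finG W_sub(1) Z1(2) W_sub(2) by (simp, blast)
    have "x \<in> \<pi> ` Z" if x: "poly (polK p) x = 0" for x
    proof (cases "x \<in> \<pi> ` Z1")
      case False
      have "\<bar>x\<bar> < \<pi> b" using boundK x polK by simp
      then have "\<pi> (- b) < x" "x < \<pi> b" by (simp_all add: homo_uminus[OF hom(1)])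
      then obtain u v where uv: "u \<in> Z1" "v \<in> Z1" "\<pi> u < x" "x < \<pi> v"
        and adj: "\<And>t. t \<in> Z1 \<Longrightarrow> \<not> (\<pi> u < \<pi> t \<and> \<pi> t < \<pi> v)"
        using neighbours[OF Z1(1) False bZ1(2) _ bZ1(1)] by metis
      then have G: "(u, v) \<in> G" using less_trans[OF uv(3,4)] by (auto simp: G_def)
      then have "x \<in> \<pi> ` W (u, v)"
        using W[OF G] uv x polK by (simp add: gap_cover_def)
      then show ?thesis using G by (auto simp: Z_def)
    qed (auto simp: Z_def)
    moreover have "\<forall>\<^sub>F y in \<Phi>. \<forall>x. poly (polR y p) x = 0 \<longrightarrow> x \<in> ev y ` Z"
    proof -
      have "\<forall>\<^sub>F y in \<Phi>. \<forall>g\<in>G. \<forall>x. ev y (fst g) < x \<longrightarrow> x < ev y (snd g) \<longrightarrow>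
          poly (polR y p') x = 0 \<longrightarrow> x \<in> ev y ` W g"
        using W finG by (intro eventually_ball_finite ballI) (auto simp: gap_cover_def)
      then show ?thesis
        using sign_less_finite[OF Z1] polR lcR
      proof eventually_elim
        case (elim y)
        show ?case
        proof (intro allI impI)
          fix x assume "poly (polR y p) x = 0"
          then have x: "poly (polR y p') x = 0" using elim(3) by simp
          show "x \<in> ev y ` Z"
          proof (cases "x \<in> ev y ` Z1")
            case False
            have "\<bar>x\<bar> < ev y b" using boundR elim(4) x by simp
            then have "ev y (- b) < x" "x < ev y b" by (simp_all add: homo_uminus[OF hom(2)])
            then obtain u v where uv: "u \<in> Z1" "v \<in> Z1" "ev y u < x" "x < ev y v"
              and adj: "\<And>t. t \<in> Z1 \<Longrightarrow> \<not> (ev y u < ev y t \<and> ev y t < ev y v)"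
              using neighbours[OF Z1(1) False bZ1(2) _ bZ1(1)] by metis
            have "(u, v) \<in> G" using uv(1,2) less_trans[OF uv(3,4)] adj elim(2) by (simp add: G_def)
            then have "x \<in> ev y ` W (u, v)" using elim(1) uv(3,4) x by force
            then show ?thesis using \<open>(u, v) \<in> G\<close> by (auto simp: Z_def)
          qed (auto simp: Z_def)
        qed
      qed
    qed
    ultimately show ?thesis
      using Z unfolding root_cover_def by blast
  qed
qed

text \<open>All roots of the polynomials in \<open>F\<close> lie in \<open>\<pi> ` \<Theta>\<close>, so some element of
  \<open>\<Theta>\<close> lies in the same gap between them as \<open>t\<close>.\<close>

lemma realize_signs:
  assumes F: "finite F" "F \<subseteq> Pol"
  shows "\<forall>\<^sub>F y in \<Phi>. \<exists>s. \<forall>p\<in>F. isgn (poly (polR y p) s) = isgn (poly (polK p) t)"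
proof -
  have "\<exists>m\<in>\<Theta>. \<forall>p\<in>F. isgn (poly (polK p) (\<pi> m)) = isgn (poly (polK p) t)"
  proof (cases "t \<in> \<pi> ` \<Theta>")
    case False
    have "\<exists>Z. polK p \<noteq> 0 \<longrightarrow> root_cover p Z" if "p \<in> F" for p
      using root_cover_exists[of p] that F by blast
    then obtain Z where Z: "\<And>p. p \<in> F \<Longrightarrow> polK p \<noteq> 0 \<Longrightarrow> root_cover p (Z p)" by metis
    define R where "R = (\<Union>p\<in>{p\<in>F. polK p \<noteq> 0}. Z p)"
    have Zp: "finite (Z p)" "Z p \<subseteq> \<Theta>" if "p \<in> F" "polK p \<noteq> 0" for p
      using Z[OF that] by (auto simp: root_cover_def)
    have R: "finite R" "R \<subseteq> \<Theta>" using F(1) Zp by (auto simp: R_def)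
    have tR: "\<pi> z \<noteq> t" if "z \<in> R" for z using False R that by auto
    have "\<exists>m\<in>\<Theta>. \<forall>z\<in>R. (\<pi> z < t \<longrightarrow> \<pi> z < \<pi> m) \<and> (t < \<pi> z \<longrightarrow> \<pi> m < \<pi> z)"
    proof -
      define L U where "L = {z\<in>R. \<pi> z < t}" and "U = {z\<in>R. t < \<pi> z}"
      have fin: "finite (\<pi> ` L)" "finite (\<pi> ` U)" using R by (auto simp: L_def U_def)
      have L: "\<exists>u\<in>\<Theta>. \<pi> u < t \<and> (\<forall>z\<in>L. \<pi> z \<le> \<pi> u)" if "L \<noteq> {}"
      proof -
        have "Max (\<pi> ` L) \<in> \<pi> ` L" using Max_in[OF fin(1)] that by simp
        then obtain u where "u \<in> L" "\<pi> u = Max (\<pi> ` L)" by auto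
        then show ?thesis
          using Max_ge[OF fin(1)] R(2) by (intro bexI[of _ u]) (auto simp: L_def)
      qed
      have U: "\<exists>v\<in>\<Theta>. t < \<pi> v \<and> (\<forall>z\<in>U. \<pi> v \<le> \<pi> z)" if "U \<noteq> {}"
      proof -
        have "Min (\<pi> ` U) \<in> \<pi> ` U" using Min_in[OF fin(2)] that by simp
        then obtain v where "v \<in> U" "\<pi> v = Min (\<pi> ` U)" by auto
        then show ?thesis
          using Min_le[OF fin(2)] R(2) by (intro bexI[of _ v]) (auto simp: U_def)
      qed
      \<comment> \<open>The gap around \<open>t\<close> may be unbounded on either side. The four
        cases are witnessed by \<open>0\<close>, \<open>v - 1\<close>, \<open>u + 1\<close> and a
        midpoint.\<close>
      have "\<exists>m\<in>\<Theta>. (\<forall>z\<in>L. \<pi> z < \<pi> m) \<and> (\<forall>z\<in>U. \<pi> m < \<pi> z)"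
      proof (cases "L = {}")
        case True
        show ?thesis
        proof (cases "U = {}")
          case True
          then show ?thesis using \<open>L = {}\<close> in_\<Theta>(1) by blast
        next
          case False
          then obtain v where v: "v \<in> \<Theta>" "\<forall>z\<in>U. \<pi> v \<le> \<pi> z" using U by blast
          then show ?thesis using \<open>L = {}\<close> in_\<Theta>(3)[OF v(1) in_\<Theta>(2)]
            by (intro bexI[of _ "v - 1"]) (auto simp: homo_diff[OF hom(1)] homo_1[OF hom(1)] less_le_trans[of "\<pi> v - 1" "\<pi> v"])
        qed
      next
        case False
        then obtain u where u: "u \<in> \<Theta>" "\<pi> u < t" "\<forall>z\<in>L. \<pi> z \<le> \<pi> u" using L by blast
        show ?thesis
        proof (cases "U = {}")
          case True
          then show ?thesis using u(3) in_\<Theta>(6)[OF u(1) in_\<Theta>(2)]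
            by (intro bexI[of _ "u + 1"]) (auto simp: homo_add[OF hom(1)] homo_1[OF hom(1)] le_less_trans[of _ "\<pi> u" "\<pi> u + 1"])
        next
          case False
          then obtain v where v: "v \<in> \<Theta>" "t < \<pi> v" "\<forall>z\<in>U. \<pi> v \<le> \<pi> z" using U by blast
          obtain m where m: "m \<in> \<Theta>" "\<pi> m = (\<pi> u + \<pi> v) / 2" using midpoint_in[OF u(1) v(1)] by blast
          have "\<pi> u < \<pi> m" "\<pi> m < \<pi> v" using m(2) less_trans[OF u(2) v(2)] by (auto simp: field_simps)
          then show ?thesis using m(1) u(3) v(3) by (meson le_less_trans less_le_trans)
        qed
      qed
      then show ?thesis unfolding L_def U_def by blast
    qed
    then obtain m where m: "m \<in> \<Theta>" "\<And>z. z \<in> R \<Longrightarrow> \<pi> z < t \<Longrightarrow> \<pi> z < \<pi> m" "\<And>z. z \<in> R \<Longrightarrow> t < \<pi> z \<Longrightarrow> \<pi> m < \<pi> z"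
      by blast
    have "isgn (poly (polK p) (\<pi> m)) = isgn (poly (polK p) t)" if p: "p \<in> F" for p
    proof (cases "polK p = 0")
      case False
      have root: "\<exists>z\<in>R. x = \<pi> z" if "poly (polK p) x = 0" for x
        using Z[OF p False] that p False unfolding root_cover_def R_def by blast
      show ?thesis
      proof (cases "\<pi> m \<le> t")
        case True
        show ?thesis
        proof (rule isgn_eq_if_no_root[OF True])
          fix x assume x: "\<pi> m \<le> x" "x \<le> t"
          show "poly (polK p) x \<noteq> 0"
          proof
            assume "poly (polK p) x = 0"
            then obtain z where z: "z \<in> R" "x = \<pi> z" using root by blast
            then show False using m(2)[of z] tR[of z] x by auto
          qed
        qed
      next
        case False
        then have "t \<le> \<pi> m" by simp
        then show ?thesis
        proof (rule isgn_eq_if_no_root[symmetric])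
          fix x assume x: "t \<le> x" "x \<le> \<pi> m"
          show "poly (polK p) x \<noteq> 0"
          proof
            assume "poly (polK p) x = 0"
            then obtain z where z: "z \<in> R" "x = \<pi> z" using root by blast
            then show False using m(3)[of z] tR[of z] x by auto
          qed
        qed
      qed
    qed simp
    then show ?thesis using m(1) by blast
  qed auto
  then obtain m where m: "m \<in> \<Theta>" "\<And>p. p \<in> F \<Longrightarrow> isgn (poly (polK p) (\<pi> m)) = isgn (poly (polK p) t)"
    by blast
  have "\<forall>\<^sub>F y in \<Phi>. \<forall>p\<in>F. isgn (poly (polR y p) (ev y m)) = isgn (poly (polK p) (\<pi> m))"
    using F m(1) by (intro eventually_ball_finite ballI sign_poly) auto
  then show ?thesis
  proof eventually_elim
    case (elim y)
    then show ?case using m(2) by (intro exI[of _ "ev y m"]) simp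
  qed
qed

end

text \<open>The product ring of \<open>K\<close> with all functions on the sample points. Despite
  the name, functions that agree eventually are not identified.\<close>

datatype ('k, 'y, 'r) germ = Germ (limit: 'k) (sample: "'y \<Rightarrow> 'r")

instantiation germ :: (comm_ring_1, type, comm_ring_1) comm_ring_1
begin

definition "0 = Germ 0 (\<lambda>_. 0)"
definition "1 = Germ 1 (\<lambda>_. 1)"
definition "a + b = Germ (limit a + limit b) (\<lambda>y. sample a y + sample b y)"
definition "a - b = Germ (limit a - limit b) (\<lambda>y. sample a y - sample b y)"
definition "- a = Germ (- limit a) (\<lambda>y. - sample a y)"
definition "a * b = Germ (limit a * limit b) (\<lambda>y. sample a y * sample b y)"

instance
  by standard
    (simp_all add: zero_germ_def one_germ_def plus_germ_def minus_germ_def uminus_germ_def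
      times_germ_def algebra_simps)

end

lemma ring_homo_limit: "ring_homo limit" and ring_homo_sample: "ring_homo (\<lambda>g. sample g y)"
  by (simp_all add: ring_homo_def one_germ_def plus_germ_def times_germ_def)

lemma map_poly_homo_comp:
  assumes "ring_homo g" "ring_homo h"
  shows "map_poly g (map_poly h p) = map_poly (\<lambda>x. g (h x)) p"
  by (simp add: map_poly_map_poly homo_0[OF assms(1)] homo_0[OF assms(2)] o_def)

lemma subring_image:
  assumes "ring_homo h"
  shows "subring_set (range h)"
  unfolding subring_set_def
  by (auto simp flip: homo_1[OF assms] homo_diff[OF assms] homo_mult[OF assms])

lemma subring_chain_Union:
  assumes "C \<noteq> {}" "subset.chain \<A> C" "\<And>S. S \<in> C \<Longrightarrow> subring_set S"
  shows "subring_set (\<Union>C)"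
proof -
  have "\<exists>S\<in>C. a \<in> S \<and> b \<in> S" if "a \<in> \<Union>C" "b \<in> \<Union>C" for a b
    using that assms(2) unfolding subset_chain_def by blast
  moreover have "1 \<in> \<Union>C"
    using assms(1,3) subring_1 by blast
  ultimately show ?thesis
    using assms(3) unfolding subring_set_def by blast
qed

text \<open>\<open>emb\<close> represents each coefficient by a pair. Preservation of signs is a
  condition on single elements and so survives unions of chains; Zorn's lemma then supplies the
  maximal ring required by the locale.\<close>

lemma realize_signs_homo:
  fixes \<sigma> :: "'a::comm_ring_1 \<Rightarrow> 'k::real_closed_field"
    and \<tau> :: "'y \<Rightarrow> 'a \<Rightarrow> 'r::real_closed_field"
  assumes hom: "ring_homo \<sigma>" "\<And>y. ring_homo (\<tau> y)"
    and sign: "\<And>a. \<forall>\<^sub>F y in \<Phi>. isgn (\<tau> y a) = isgn (\<sigma> a)"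
    and "finite F"
  shows "\<forall>\<^sub>F y in \<Phi>. \<exists>s. \<forall>p\<in>F. isgn (poly (map_poly (\<tau> y) p) s) = isgn (poly (map_poly \<sigma> p) t)"
proof -
  define emb where "emb a = Germ (\<sigma> a) (\<lambda>y. \<tau> y a)" for a
  have emb: "ring_homo emb"
    using hom by (simp add: emb_def ring_homo_def one_germ_def plus_germ_def times_germ_def)
  define ok where "ok \<Theta> \<longleftrightarrow> subring_set \<Theta> \<and> range emb \<subseteq> \<Theta> \<and>
    (\<forall>g\<in>\<Theta>. \<forall>\<^sub>F y in \<Phi>. isgn (sample g y) = isgn (limit g))" for \<Theta>
  have "\<exists>M\<in>Collect ok. \<forall>S\<in>Collect ok. M \<subseteq> S \<longrightarrow> S = M"
  proof (rule subset_Zorn_nonempty)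
    have "ok (range emb)"
      using sign subring_image[OF emb] by (auto simp: ok_def emb_def)
    then show "Collect ok \<noteq> {}" by blast
  next
    fix C assume C: "C \<noteq> {}" "subset.chain (Collect ok) C"
    then have "\<And>S. S \<in> C \<Longrightarrow> ok S" by (auto simp: subset_chain_def)
    then show "\<Union>C \<in> Collect ok"
      using subring_chain_Union[OF C] C(1) unfolding ok_def by blast
  qed
  then obtain M where M: "ok M" "\<And>S. ok S \<Longrightarrow> M \<subseteq> S \<Longrightarrow> S = M" by blast
  interpret sign_preserving_pairs limit "\<lambda>y g. sample g y" \<Phi> M
  proof
    show "\<exists>b. limit b = a \<and> (\<forall>y. sample b y = \<rho> y)" for a and \<rho> :: "'y \<Rightarrow> 'r"
      by (intro exI[of _ "Germ a \<rho>"]) simp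
    show "\<Theta>' \<subseteq> M" if "subring_set \<Theta>'" "M \<subseteq> \<Theta>'"
      "\<And>b. b \<in> \<Theta>' \<Longrightarrow> \<forall>\<^sub>F y in \<Phi>. isgn (sample b y) = isgn (limit b)" for \<Theta>'
    proof -
      have "ok \<Theta>'" using that M(1) unfolding ok_def by blast
      then show ?thesis using M(2) that(2) by blast
    qed
  qed (use M(1) ring_homo_limit ring_homo_sample in \<open>auto simp: ok_def\<close>)
  have "map_poly emb p \<in> polys_over M" for p
    using M(1) unfolding ok_def polys_over_def by (auto simp: coeff_map_homo[OF emb])
  then have "\<forall>\<^sub>F y in \<Phi>. \<exists>s. \<forall>p\<in>map_poly emb ` F. isgn (poly (map_poly (\<lambda>g. sample g y) p) s) =
      isgn (poly (map_poly limit p) t)"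
    using \<open>finite F\<close> by (intro realize_signs) auto
  then show ?thesis
    by (simp add: map_poly_homo_comp[OF ring_homo_limit emb] map_poly_homo_comp[OF ring_homo_sample emb])
      (simp add: emb_def)
qed

section \<open>Evaluation of multivariate polynomials\<close>

definition monomial_value :: "('v \<Rightarrow> 'b::comm_semiring_1) \<Rightarrow> ('v \<Rightarrow>\<^sub>0 nat) \<Rightarrow> 'b" where
  "monomial_value x m = (\<Prod>v\<in>Poly_Mapping.keys m. x v ^ Poly_Mapping.lookup m v)"

lemma monomial_value_add: "monomial_value x (m + n) = monomial_value x m * monomial_value x n"
proof -
  define V where "V = Poly_Mapping.keys m \<union> Poly_Mapping.keys n"
  have *: "monomial_value x k = (\<Prod>v\<in>V. x v ^ Poly_Mapping.lookup k v)" if "Poly_Mapping.keys k \<subseteq> V" for k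
    unfolding monomial_value_def using that
    by (intro prod.mono_neutral_left) (auto simp: V_def in_keys_iff)
  show ?thesis
    using Poly_Mapping.keys_add[of m n]
    by (simp add: * V_def lookup_add power_add prod.distrib)
qed

lemma sum_monomials:
  "p = (\<Sum>m\<in>Poly_Mapping.keys p. Poly_Mapping.single m (Poly_Mapping.lookup p m))"
  by (rule poly_mapping_eqI) (auto simp: lookup_sum lookup_single when_def in_keys_iff)

context
  fixes h :: "'a::comm_ring_1 \<Rightarrow> 'b::comm_ring_1" and x :: "'v \<Rightarrow> 'b"
  assumes h: "ring_homo h"
begin

lemma meval_single: "meval h x (Poly_Mapping.single m c) = h c * monomial_value x m"
  by (simp add: meval_def monomial_value_def homo_0[OF h])

lemma meval_mconst: "meval h x (mconst c) = h c"
  by (simp add: mconst_def meval_single monomial_value_def)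

lemma meval_mvar: "meval h x (mvar v) = x v"
  by (simp add: mvar_def meval_single monomial_value_def homo_1[OF h])

lemma meval_eq_sum_superset:
  assumes "finite A" "Poly_Mapping.keys p \<subseteq> A"
  shows "meval h x p = (\<Sum>m\<in>A. h (Poly_Mapping.lookup p m) * monomial_value x m)"
  unfolding meval_def monomial_value_def using assms
  by (intro sum.mono_neutral_left) (auto simp: in_keys_iff homo_0[OF h])

lemma meval_add: "meval h x (p + q) = meval h x p + meval h x q"
  using Poly_Mapping.keys_add[of p q]
  by (simp add: meval_eq_sum_superset[of "Poly_Mapping.keys p \<union> Poly_Mapping.keys q"] lookup_add
    homo_add[OF h] algebra_simps sum.distrib)

lemma meval_0: "meval h x 0 = 0"
  by (simp add: meval_def)

lemma meval_sum: "meval h x (sum f A) = (\<Sum>a\<in>A. meval h x (f a))"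
  by (induction A rule: infinite_finite_induct) (auto simp: meval_0 meval_add)

lemma meval_mult: "meval h x (p * q) = meval h x p * meval h x q"
proof -
  let ?P = "Poly_Mapping.keys p" and ?Q = "Poly_Mapping.keys q"
  let ?p = "Poly_Mapping.lookup p" and ?q = "Poly_Mapping.lookup q"
  have "p * q = (\<Sum>m\<in>?P. Poly_Mapping.single m (?p m)) * (\<Sum>n\<in>?Q. Poly_Mapping.single n (?q n))"
    by (simp flip: sum_monomials)
  also have "\<dots> = (\<Sum>m\<in>?P. \<Sum>n\<in>?Q. Poly_Mapping.single (m + n) (?p m * ?q n))"
    by (simp add: sum_product mult_single)
  finally have "meval h x (p * q) = (\<Sum>m\<in>?P. \<Sum>n\<in>?Q. h (?p m * ?q n) * monomial_value x (m + n))"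
    by (simp add: meval_sum meval_single)
  also have "\<dots> = meval h x p * meval h x q"
    by (simp add: meval_def monomial_value_def[symmetric] monomial_value_add homo_mult[OF h]
      sum_product algebra_simps)
  finally show ?thesis .
qed

lemma ring_homo_meval: "ring_homo (meval h x)"
  unfolding ring_homo_def
  using meval_mconst[of 1] by (auto simp: meval_add meval_mult mconst_def homo_1[OF h])

end

lemma homo_meval:
  assumes "ring_homo \<psi>"
  shows "\<psi> (meval h x p) = meval (\<lambda>c. \<psi> (h c)) (\<lambda>v. \<psi> (x v)) p"
  unfolding meval_def
  by (simp add: homo_sum[OF assms] homo_mult[OF assms] homo_prod[OF assms] homo_power[OF assms])

lemma ring_homo_id: "ring_homo id"
  by (simp add: ring_homo_def)

lemma ring_homo_poly: "ring_homo (\<lambda>q. poly q t)"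
  by (simp add: ring_homo_def)

lemma ring_homo_comp: "ring_homo f \<Longrightarrow> ring_homo g \<Longrightarrow> ring_homo (\<lambda>x. f (g x))"
  by (simp add: ring_homo_def)

text \<open>The coefficients no longer contain \<open>v\<close> but keep their type, so eliminating
  a coordinate does not change the type of variables.\<close>

definition as_univariate :: "'v \<Rightarrow> ('v, 'a::comm_ring_1) mpoly \<Rightarrow> ('v, 'a) mpoly poly" where
  "as_univariate v = meval (\<lambda>c. [:mconst c:]) (\<lambda>w. if w = v then [:0, 1:] else [:mvar w:])"

lemma poly_as_univariate:
  assumes g: "ring_homo g"
  shows "poly (map_poly (meval g \<theta>) (as_univariate v p)) t = meval g (\<theta>(v := t)) p"
proof -
  note G = ring_homo_meval[OF g, of \<theta>]
  have "ring_homo (\<lambda>q. poly (map_poly (meval g \<theta>) q) t)"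
    by (rule ring_homo_comp[OF ring_homo_poly map_poly_homo[OF G]])
  from homo_meval[OF this, of "\<lambda>c. [:mconst c:]" "\<lambda>w. if w = v then [:0, 1:] else [:mvar w:]" p]
  show ?thesis
    by (simp add: as_univariate_def map_poly_homo_pCons[OF G] meval_mconst[OF g] meval_mvar[OF g]
        homo_0[OF G] homo_1[OF G] if_distrib if_distribR fun_upd_def cong: if_cong)
qed

text \<open>Partial points are encoded as total points that vanish outside \<open>W\<close>, so that
  all stages of the induction on coordinates share one type.\<close>

definition restrict_point :: "'v set \<Rightarrow> ('v \<Rightarrow> 'a::zero) \<Rightarrow> 'v \<Rightarrow> 'a" where
  "restrict_point W y = (\<lambda>v. if v \<in> W then y v else 0)"

text \<open>The induction hypothesis ranges over all finite sets of polynomials. It is thus the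
  finite intersection property of the sets \<open>A p\<close>, and lets every eventual assertion
  about their filter be realized by an actual point.\<close>

lemma transfer_signs_to_reals:
  fixes x :: "'v::finite \<Rightarrow> 'k::real_closed_field" and h :: "real \<Rightarrow> 'k"
  assumes h: "ring_homo h" and S: "finite S"
  shows "\<exists>y. \<forall>p\<in>S. isgn (meval id y p) = isgn (meval h x p)"
proof -
  \<comment> \<open>No order is assumed of \<open>h\<close>: a positive real is a nonzero square,
    and \<open>h\<close> maps it to a nonzero square.\<close>
  have isgn_h: "isgn (h c) = isgn c" for c
  proof -
    have pos: "h c > 0" if "c > 0" for c
    proof -
      have "h c = (h (sqrt c))\<^sup>2"
        using that by (simp add: homo_power[OF h, symmetric])
      moreover have "h c * h (inverse c) = 1"
        using that by (simp add: homo_mult[OF h, symmetric] homo_1[OF h])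
      ultimately show ?thesis by (metis mult_zero_left zero_less_power2 zero_neq_one power_zero_numeral)
    qed
    show ?thesis
      using pos[of c] pos[of "- c"] homo_0[OF h] by (auto simp: isgn_def homo_uminus[OF h])
  qed
  have "\<forall>S. finite S \<longrightarrow> (\<exists>y. \<forall>p\<in>S. isgn (meval id (restrict_point W y) p) = isgn (meval h (restrict_point W x) p))"
    if "finite W" for W
    using that
  proof (induction W rule: finite_induct)
    case empty
    \<comment> \<open>At the zero point the value over \<open>K\<close> is the image under
      \<open>h\<close> of the real value.\<close>
    have "isgn (meval id (restrict_point {} y) p) = isgn (meval h (restrict_point {} x) p)" for y p
      using homo_meval[OF h, of id "\<lambda>_. 0" p] isgn_h[of "meval id (\<lambda>_. 0) p"]
      by (simp add: restrict_point_def homo_0[OF h])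
    then show ?case by blast
  next
    case (insert v W)
    define A where "A p = {y. isgn (meval id (restrict_point W y) p) = isgn (meval h (restrict_point W x) p)}" for p
    define \<Phi> where "\<Phi> = (INF p. principal (A p))"
    have ex: "\<exists>y. P y" if ev: "eventually P \<Phi>" for P
    proof -
      obtain T where T: "finite T" "eventually P (INF p\<in>T. principal (A p))"
        using iffD1[OF eventually_INF ev[unfolded \<Phi>_def]] by blast
      then have "\<forall>y\<in>(\<Inter>p\<in>T. A p). P y"
        by (simp add: INF_principal_finite eventually_principal)
      moreover obtain y where "\<forall>p\<in>T. y \<in> A p"
        using insert.IH T(1) unfolding A_def by blast
      ultimately show ?thesis by blast
    qed
    show ?case
    proof (intro allI impI)
      fix S :: "('v, real) mpoly set" assume "finite S"
      have "\<forall>\<^sub>F y in \<Phi>. \<exists>s. \<forall>P\<in>as_univariate v ` S.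
          isgn (poly (map_poly (meval id (restrict_point W y)) P) s) = isgn (poly (map_poly (meval h (restrict_point W x)) P) (x v))"
      proof (rule realize_signs_homo)
        show "\<forall>\<^sub>F y in \<Phi>. isgn (meval id (restrict_point W y) p) = isgn (meval h (restrict_point W x) p)" for p
          unfolding \<Phi>_def by (rule eventually_INF1[of p]) (auto simp: eventually_principal A_def)
      qed (use \<open>finite S\<close> ring_homo_meval ring_homo_id h in auto)
      from ex[OF this] obtain y s where y: "\<And>p. p \<in> S \<Longrightarrow> isgn (meval id ((restrict_point W y)(v := s)) p) = isgn (meval h ((restrict_point W x)(v := x v)) p)"
        by (auto simp: poly_as_univariate[OF ring_homo_id] poly_as_univariate[OF h])
      have "(restrict_point W y)(v := s) = restrict_point (insert v W) (y(v := s))" "(restrict_point W x)(v := x v) = restrict_point (insert v W) x"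
        using insert.hyps by (auto simp: restrict_point_def)
      then show "\<exists>y. \<forall>p\<in>S. isgn (meval id (restrict_point (insert v W) y) p) = isgn (meval h (restrict_point (insert v W) x) p)"
        using y by (intro exI[of _ "y(v := s)"]) simp
    qed
  qed
  from this[OF finite_class.finite_UNIV] S show ?thesis
    by (simp add: restrict_point_def)
qed

section \<open>Real prime ideals and real closures\<close>

definition is_sos :: "'a::comm_ring_1 \<Rightarrow> bool" where
  "is_sos a \<longleftrightarrow> (\<exists>qs. a = (\<Sum>q\<leftarrow>qs. q\<^sup>2))"

lemma is_sos_0: "is_sos 0"
  unfolding is_sos_def by (rule exI[of _ "[]"]) simp

lemma is_sos_square: "is_sos (q\<^sup>2)"
  unfolding is_sos_def by (rule exI[of _ "[q]"]) simp

lemma is_sos_add: "is_sos a \<Longrightarrow> is_sos b \<Longrightarrow> is_sos (a + b)"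
  unfolding is_sos_def by (elim exE, rename_tac ps qs, rule_tac x = "ps @ qs" in exI) simp

lemma is_sos_square_mult: "is_sos a \<Longrightarrow> is_sos (c\<^sup>2 * a)"
proof -
  assume "is_sos a"
  then obtain qs where "a = (\<Sum>q\<leftarrow>qs. q\<^sup>2)" by (auto simp: is_sos_def)
  then have "c\<^sup>2 * a = (\<Sum>q\<leftarrow>map (\<lambda>q. c * q) qs. q\<^sup>2)"
    by (simp add: sum_list_const_mult power_mult_distrib o_def)
  then show ?thesis unfolding is_sos_def by blast
qed

lemma is_sos_mult: "is_sos a \<Longrightarrow> is_sos b \<Longrightarrow> is_sos (a * b)"
proof -
  assume "is_sos a" and b: "is_sos b"
  then obtain qs where a: "a = (\<Sum>q\<leftarrow>qs. q\<^sup>2)" by (auto simp: is_sos_def)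
  have "is_sos ((\<Sum>q\<leftarrow>qs. q\<^sup>2) * b)"
    by (induction qs) (auto simp: is_sos_0 distrib_right intro: is_sos_add is_sos_square_mult b)
  then show ?thesis using a by simp
qed

definition ideal_set :: "'a::comm_ring_1 set \<Rightarrow> bool" where
  "ideal_set J \<longleftrightarrow> 0 \<in> J \<and> (\<forall>a\<in>J. \<forall>b\<in>J. a + b \<in> J) \<and> (\<forall>a. \<forall>b\<in>J. a * b \<in> J)"

text \<open>The last clause makes the quotient formally real: a square can be separated from a sum
  of squares.\<close>

definition real_prime :: "'a::comm_ring_1 set \<Rightarrow> bool" where
  "real_prime J \<longleftrightarrow> ideal_set J \<and> 1 \<notin> J \<and> (\<forall>a b. a * b \<in> J \<longrightarrow> a \<in> J \<or> b \<in> J) \<and>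
    (\<forall>a s. is_sos s \<longrightarrow> a\<^sup>2 + s \<in> J \<longrightarrow> a \<in> J)"

lemma ideal_set_uminus: "ideal_set J \<Longrightarrow> a \<in> J \<Longrightarrow> - a \<in> J"
  unfolding ideal_set_def by (metis mult_minus1)

text \<open>The ideals maximal among those containing no \<open>1 + s\<close> with \<open>s\<close> a sum of squares are prime and real.\<close>

lemma real_prime_exists:
  fixes I :: "'a::comm_ring_1 set"
  assumes I: "ideal_set I" "\<And>s. is_sos s \<Longrightarrow> 1 + s \<notin> I"
  obtains J where "real_prime J" "I \<subseteq> J"
proof -
  define ok where "ok J \<longleftrightarrow> ideal_set J \<and> I \<subseteq> J \<and> (\<forall>s. is_sos s \<longrightarrow> 1 + s \<notin> J)" for J
  have "\<exists>M\<in>Collect ok. \<forall>S\<in>Collect ok. M \<subseteq> S \<longrightarrow> S = M"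
  proof (rule subset_Zorn_nonempty)
    show "Collect ok \<noteq> {}" using I by (auto simp: ok_def)
  next
    fix C assume C: "C \<noteq> {}" "subset.chain (Collect ok) C"
    then have ok: "\<And>S. S \<in> C \<Longrightarrow> ok S" by (auto simp: subset_chain_def)
    have two: "\<exists>S\<in>C. a \<in> S \<and> b \<in> S" if "a \<in> \<Union>C" "b \<in> \<Union>C" for a b
      using that C(2) unfolding subset_chain_def by blast
    have "ideal_set (\<Union>C)"
      unfolding ideal_set_def
    proof (intro conjI ballI allI)
      show "0 \<in> \<Union>C" using C(1) ok unfolding ok_def ideal_set_def by blast
    next
      fix a b assume "a \<in> \<Union>C" "b \<in> \<Union>C"
      then obtain S where "S \<in> C" "a \<in> S" "b \<in> S" using two by blast
      then show "a + b \<in> \<Union>C" using ok[of S] unfolding ok_def ideal_set_def by blast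
    next
      fix a b assume "b \<in> \<Union>C"
      then show "a * b \<in> \<Union>C" using ok unfolding ok_def ideal_set_def by blast
    qed
    then show "\<Union>C \<in> Collect ok"
      using C(1) ok unfolding ok_def by blast
  qed
  then obtain M where M: "ok M" "\<And>S. ok S \<Longrightarrow> M \<subseteq> S \<Longrightarrow> S = M" by blast
  have M1: "1 + s \<notin> M" if "is_sos s" for s
    using M(1) that by (auto simp: ok_def)
  have id: "ideal_set M" and IM: "I \<subseteq> M"
    using M(1) by (auto simp: ok_def)
  have Madd: "a + b \<in> M" if "a \<in> M" "b \<in> M" for a b
    using id that by (auto simp: ideal_set_def)
  have Mmult: "c * a \<in> M" if "a \<in> M" for a c
    using id that by (auto simp: ideal_set_def)
  \<comment> \<open>The ideal generated by \<open>M\<close> and \<open>a\<close> is larger than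
    \<open>M\<close>, so by maximality it contains some \<open>1 + t\<close>.\<close>
  have extend: "\<exists>t j b. is_sos t \<and> j \<in> M \<and> 1 + t = j + b * a" if "a \<notin> M" for a
  proof (rule ccontr)
    assume *: "\<not> ?thesis"
    define S where "S = {j + b * a | j b. j \<in> M}"
    have "ideal_set S"
      unfolding ideal_set_def
    proof (intro conjI ballI allI)
      show "0 \<in> S" unfolding S_def using id by (auto simp: ideal_set_def intro!: exI[of _ 0])
    next
      fix x y assume "x \<in> S" "y \<in> S"
      then obtain j b k c where "x = j + b * a" "y = k + c * a" "j \<in> M" "k \<in> M"
        unfolding S_def by blast
      then have "x + y = (j + k) + (b + c) * a" "j + k \<in> M"
        using Madd by (simp_all add: algebra_simps)
      then show "x + y \<in> S" unfolding S_def by blast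
    next
      fix c x assume "x \<in> S"
      then obtain j b where "x = j + b * a" "j \<in> M" unfolding S_def by blast
      then have "c * x = c * j + (c * b) * a" "c * j \<in> M"
        by (simp add: algebra_simps) (rule Mmult[OF \<open>j \<in> M\<close>])
      then show "c * x \<in> S" unfolding S_def by blast
    qed
    moreover have sub: "M \<subseteq> S"
    proof
      fix j assume "j \<in> M"
      then have "j = j + 0 * a \<and> j \<in> M" by simp
      then show "j \<in> S" unfolding S_def by blast
    qed
    moreover have "1 + s \<notin> S" if "is_sos s" for s
      using * that unfolding S_def by blast
    ultimately have "ok S" using IM unfolding ok_def by blast
    then have "S = M" using M(2) sub by blast
    moreover have "a \<in> S"
    proof -
      have "a = 0 + 1 * a \<and> 0 \<in> M" using id by (simp add: ideal_set_def)
      then show ?thesis unfolding S_def by blast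
    qed
    ultimately show False using that by blast
  qed
  have "real_prime M"
    unfolding real_prime_def
  proof (intro conjI allI impI id)
    show "1 \<notin> M" using M1[OF is_sos_0] by simp
  next
    fix a b assume ab: "a * b \<in> M"
    show "a \<in> M \<or> b \<in> M"
    proof (rule ccontr)
      assume "\<not> (a \<in> M \<or> b \<in> M)"
      then obtain t j x u k y where t: "is_sos t" "j \<in> M" "1 + t = j + x * a"
        and u: "is_sos u" "k \<in> M" "1 + u = k + y * b"
        using extend[of a] extend[of b] by blast
      \<comment> \<open>Modulo \<open>M\<close> the two factors are \<open>x * a\<close> and
        \<open>y * b\<close>, and their product is a multiple of \<open>a * b\<close>.\<close>
      have "1 + (t + u + t * u) = (1 + t) * (1 + u)" by (simp add: algebra_simps)
      also have "\<dots> = (k + y * b) * j + (x * a) * k + (x * y) * (a * b)"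
        unfolding t(3) u(3) by (simp add: algebra_simps)
      also have "\<dots> \<in> M" by (intro Madd Mmult t u ab)
      finally have "1 + (t + u + t * u) \<in> M" .
      moreover have "is_sos (t + u + t * u)"
        by (intro is_sos_add is_sos_mult t(1) u(1))
      ultimately show False using M1 by blast
    qed
  next
    fix a s assume s: "is_sos s" "a\<^sup>2 + s \<in> M"
    show "a \<in> M"
    proof (rule ccontr)
      assume "a \<notin> M"
      then obtain t j b where t: "is_sos t" "j \<in> M" "1 + t = j + b * a"
        using extend[of a] by blast
      \<comment> \<open>Modulo \<open>M\<close> the square of \<open>1 + t\<close> is that of
        \<open>b * a\<close>, which with the term in \<open>s\<close> becomes a multiple of the
        given element of \<open>M\<close>.\<close>
      have "1 + ((t + t) + t * t + b\<^sup>2 * s) = (1 + t)\<^sup>2 + b\<^sup>2 * s"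
        by (simp add: algebra_simps power2_eq_square)
      also have "\<dots> = (j + 2 * (b * a)) * j + b\<^sup>2 * (a\<^sup>2 + s)"
        unfolding t(3) by (simp add: algebra_simps power2_eq_square)
      also have "\<dots> \<in> M" by (intro Madd Mmult t s)
      finally have "1 + ((t + t) + t * t + b\<^sup>2 * s) \<in> M" .
      moreover have "is_sos ((t + t) + t * t + b\<^sup>2 * s)"
        by (intro is_sos_add is_sos_mult is_sos_square t(1) s(1))
      ultimately show False using M1 by blast
    qed
  qed
  then show thesis using that IM by blast
qed

text \<open>A class, so that the real closure can be a type constructor applied to a coordinate
  ring.\<close>

class real_domain = idom +
  assumes sum_list_squares_eq_0: "sum_list (map (\<lambda>x. x * x) xs) = 0 \<Longrightarrow> x \<in> set xs \<Longrightarrow> x = 0"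

section \<open>Maximal real subrings of an algebraically closed field\<close>

definition real_set :: "'a::comm_ring_1 set \<Rightarrow> bool" where
  "real_set S \<longleftrightarrow> (\<forall>xs. set xs \<subseteq> S \<longrightarrow> (\<Sum>x\<leftarrow>xs. x\<^sup>2) = 0 \<longrightarrow> (\<forall>x\<in>set xs. x = 0))"

text \<open>Maximality among subrings instead of subfields keeps the Zorn argument to plain unions;
  closure under inverses then follows.\<close>

locale maximal_real_subring =
  fixes S :: "'c::alg_closed_field set"
  assumes subring: "subring_set S" and real: "real_set S"
    and maximal: "\<And>S'. subring_set S' \<Longrightarrow> real_set S' \<Longrightarrow> S \<subseteq> S' \<Longrightarrow> S' = S"
begin

lemmas in_S = subring_intros[OF subring]
lemmas in_PS = subring_intros[OF subring_polys_over[OF subring]]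

text \<open>Used in contrapositive form: an element outside \<open>S\<close> yields a vanishing sum
  of squares of its polynomial expressions in which some summand is nonzero.\<close>

lemma adjoin:
  assumes "\<And>qs. set qs \<subseteq> polys_over S \<Longrightarrow> (\<Sum>q\<leftarrow>qs. (poly q \<theta>)\<^sup>2) = 0 \<Longrightarrow> \<forall>q\<in>set qs. poly q \<theta> = 0"
  shows "\<theta> \<in> S"
proof -
  define S' where "S' = (\<lambda>q. poly q \<theta>) ` polys_over S"
  have "subring_set S'"
    unfolding subring_set_def S'_def
  proof (intro conjI ballI; (elim imageE)?; hypsubst?)
    show "1 \<in> (\<lambda>q. poly q \<theta>) ` polys_over S"
      by (rule image_eqI[of _ _ 1]) (auto intro: in_PS)
    fix p q assume pq: "p \<in> polys_over S" "q \<in> polys_over S"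
    show "poly p \<theta> - poly q \<theta> \<in> (\<lambda>q. poly q \<theta>) ` polys_over S"
      by (rule image_eqI[of _ _ "p - q"]) (use pq in_PS(3) in auto)
    show "poly p \<theta> * poly q \<theta> \<in> (\<lambda>q. poly q \<theta>) ` polys_over S"
      by (rule image_eqI[of _ _ "p * q"]) (use pq in_PS(4) in auto)
  qed
  moreover have "real_set S'"
    unfolding real_set_def
  proof (intro allI impI)
    fix xs assume xs: "set xs \<subseteq> S'" "(\<Sum>x\<leftarrow>xs. x\<^sup>2) = 0"
    then have "xs \<in> lists S'" by auto
    then obtain qs where "qs \<in> lists (polys_over S)" and qs: "xs = map (\<lambda>q. poly q \<theta>) qs"
      unfolding S'_def lists_image by blast
    then have "set qs \<subseteq> polys_over S" by auto
    then show "\<forall>x\<in>set xs. x = 0"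
      using assms[of qs] xs(2) by (simp add: qs o_def)
  qed
  moreover have "S \<subseteq> S'"
  proof
    fix a assume "a \<in> S"
    then show "a \<in> S'" unfolding S'_def
      by (intro image_eqI[of _ _ "[:a:]"] pCons_polys_over[OF subring] in_PS) auto
  qed
  ultimately have "S' = S" by (rule maximal)
  moreover have "\<theta> \<in> S'" unfolding S'_def
    by (intro image_eqI[of _ _ "[:0, 1:]"] pCons_polys_over[OF subring] in_PS in_S) auto
  ultimately show ?thesis by blast
qed

lemma sum_list_in: "set xs \<subseteq> S \<Longrightarrow> sum_list xs \<in> S"
  by (induction xs) (auto intro: in_S)

text \<open>Multiplication by \<open>s ^ N\<close> clears all denominators in a vanishing sum of
  squares and moves it into the real set \<open>S\<close>.\<close>

lemma inverse_in:
  assumes s: "s \<in> S"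
  shows "inverse s \<in> S"
proof (cases "s = 0")
  case False
  show ?thesis
  proof (rule adjoin)
    fix qs assume qs: "set qs \<subseteq> polys_over S" "(\<Sum>q\<leftarrow>qs. (poly q (inverse s))\<^sup>2) = 0"
    define N where "N = (\<Sum>q\<leftarrow>qs. degree q)"
    define e where "e q = s ^ N * poly q (inverse s)" for q
    have e: "e q \<in> S" if q: "q \<in> set qs" for q
    proof -
      have deg: "degree q \<le> N" unfolding N_def using q by (induction qs) auto
      have "poly q (inverse s) = (\<Sum>i\<le>N. coeff q i * inverse s ^ i)"
        by (rule poly_eq_sum_atMost[OF deg])
      then have "e q = (\<Sum>i\<le>N. coeff q i * s ^ (N - i))"
        unfolding e_def sum_distrib_left using False
        by (auto intro!: sum.cong simp: power_diff field_simps sum_distrib_left)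
      then show ?thesis
        using q qs(1) s by (auto intro!: subring_sum[OF subring] in_S simp: polys_over_def)
    qed
    have "(\<Sum>x\<leftarrow>map e qs. x\<^sup>2) = (s ^ N)\<^sup>2 * (\<Sum>q\<leftarrow>qs. (poly q (inverse s))\<^sup>2)"
      by (simp add: e_def power_mult_distrib sum_list_const_mult o_def)
    then have "\<forall>x\<in>set (map e qs). x = 0"
      using real[unfolded real_set_def, rule_format, of "map e qs"] qs(2) e by auto
    then show "\<forall>q\<in>set qs. poly q (inverse s) = 0" using False by (auto simp: e_def)
  qed
qed (auto intro: in_S)

lemma two_neq_0: "(2 :: 'c) \<noteq> 0"
proof
  assume "(2 :: 'c) = 0"
  then have "(\<Sum>x\<leftarrow>[1, 1::'c]. x\<^sup>2) = 0" by simp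
  then show False
    using real[unfolded real_set_def, rule_format, of "[1, 1]"] in_S(2) by simp
qed

text \<open>Adjoining a square root \<open>\<theta>\<close> of \<open>a\<close> must destroy
  realness. In a vanishing sum of squares of terms \<open>B + C * \<theta>\<close> the mixed part
  vanishes, and the rest expresses \<open>- a\<close> as a quotient of sums of squares.\<close>

lemma uminus_sos_if_not_square:
  assumes a: "a \<in> S" and nsq: "\<And>c. c \<in> S \<Longrightarrow> a \<noteq> c\<^sup>2"
  shows "\<exists>xs. set xs \<subseteq> S \<and> - a = (\<Sum>x\<leftarrow>xs. x\<^sup>2)"
proof -
  obtain \<theta> where \<theta>: "\<theta>\<^sup>2 = a" using nth_root_exists[of 2 a] by auto
  then have "\<theta> \<notin> S" using nsq by blast
  then obtain qs where qs: "set qs \<subseteq> polys_over S" "(\<Sum>q\<leftarrow>qs. (poly q \<theta>)\<^sup>2) = 0"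
    "\<exists>q\<in>set qs. poly q \<theta> \<noteq> 0"
    using adjoin[of \<theta>] by blast
  have "\<exists>b c. b \<in> S \<and> c \<in> S \<and> poly q \<theta> = b + c * \<theta>" if "q \<in> polys_over S" for q
    using that
  proof (induction q)
    case 0
    then show ?case using in_S(1) by (intro exI[of _ 0]) simp
  next
    case (pCons x q)
    have coeff: "coeff (pCons x q) i \<in> S" for i using pCons.prems by (simp add: polys_over_def)
    have "x \<in> S" "q \<in> polys_over S"
      using coeff[of 0] coeff[of "Suc _"] by (simp_all add: polys_over_def)
    with pCons.IH obtain b c where bc: "b \<in> S" "c \<in> S" "poly q \<theta> = b + c * \<theta>" by blast
    have "poly (pCons x q) \<theta> = (x + c * a) + b * \<theta>"
      using bc(3) \<theta> by (simp add: algebra_simps power2_eq_square)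
    then show ?case
      by (intro exI[of _ "x + c * a"] exI[of _ b] conjI in_S(6) in_S(4) bc(1,2) \<open>x \<in> S\<close> a)
  qed
  then obtain B C where BC: "\<And>q. q \<in> set qs \<Longrightarrow> B q \<in> S \<and> C q \<in> S \<and> poly q \<theta> = B q + C q * \<theta>"
    using qs(1) by (metis subset_eq)
  define b2 where "b2 = (\<Sum>q\<leftarrow>qs. (B q)\<^sup>2)"
  define c2 where "c2 = (\<Sum>q\<leftarrow>qs. (C q)\<^sup>2)"
  define bc where "bc = (\<Sum>q\<leftarrow>qs. B q * C q)"
  have "(\<Sum>q\<leftarrow>qs. (poly q \<theta>)\<^sup>2) = (\<Sum>q\<leftarrow>qs. (B q)\<^sup>2 + a * (C q)\<^sup>2 + 2 * \<theta> * (B q * C q))"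
    using BC \<theta> by (intro arg_cong[of _ _ sum_list] map_cong) (auto simp: power2_eq_square algebra_simps)
  then have eq: "b2 + a * c2 + 2 * \<theta> * bc = 0"
    using qs(2) by (simp add: b2_def c2_def bc_def sum_list_addf sum_list_const_mult)
  have in_S': "b2 \<in> S" "c2 \<in> S" "bc \<in> S"
    unfolding b2_def c2_def bc_def using BC by (auto intro!: sum_list_in in_S(4,7))
  \<comment> \<open>Otherwise the relation is linear in \<open>\<theta>\<close> with invertible
    coefficient and puts \<open>\<theta>\<close> into \<open>S\<close>.\<close>
  have "bc = 0"
  proof (rule ccontr)
    assume "bc \<noteq> 0"
    then have nz: "2 * bc \<noteq> 0" using two_neq_0 by simp
    have "(2 * bc) * \<theta> + (b2 + a * c2) = 0" using eq by (simp add: ac_simps)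
    then have "(2 * bc) * \<theta> = - (b2 + a * c2)" by (rule eq_neg_iff_add_eq_0[THEN iffD2])
    then have "\<theta> = - (b2 + a * c2) * inverse (2 * bc)"
      using nz by (metis nonzero_mult_div_cancel_left divide_inverse)
    also have "\<dots> \<in> S"
      using inverse_in[OF in_S(4)[OF in_S(8)[of 2] in_S'(3)]]
      by (intro in_S(4,5,6) in_S' a) simp_all
    finally show False using \<open>\<theta> \<notin> S\<close> by blast
  qed
  then have eq': "b2 + a * c2 = 0" using eq by simp
  have sq0: "\<forall>q\<in>set qs. f q = 0" if "\<And>q. q \<in> set qs \<Longrightarrow> f q \<in> S" "(\<Sum>q\<leftarrow>qs. (f q)\<^sup>2) = 0" for f
    using real[unfolded real_set_def, rule_format, of "map f qs"] that by (auto simp: o_def)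
  \<comment> \<open>If \<open>c2\<close> were zero, so would be \<open>b2\<close>; realness of
    \<open>S\<close> would then annihilate every \<open>B\<close> and \<open>C\<close>, against the
    nonzero summand.\<close>
  have "c2 \<noteq> 0"
  proof
    assume "c2 = 0"
    then have "b2 = 0" using eq' by simp
    then have "\<forall>q\<in>set qs. B q = 0" unfolding b2_def by (rule sq0[rotated]) (simp add: BC)
    moreover have "\<forall>q\<in>set qs. C q = 0"
      using \<open>c2 = 0\<close> unfolding c2_def by (rule sq0[rotated]) (simp add: BC)
    ultimately show False using qs(3) BC by auto
  qed
  \<comment> \<open>Writing \<open>b2 / c2\<close> as \<open>b2 * c2\<close> over the square of
    \<open>c2\<close> gives a sum of squares indexed by pairs.\<close>
  define ys where "ys = map (\<lambda>(q, r). B q * C r * inverse c2) (List.product qs qs)"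
  have "set ys \<subseteq> S"
    unfolding ys_def using BC inverse_in[OF in_S'(2)] by (auto intro!: in_S(4))
  moreover have "(\<Sum>y\<leftarrow>ys. y\<^sup>2) = b2 * c2 * (inverse c2)\<^sup>2"
  proof -
    have "(\<Sum>y\<leftarrow>ys. y\<^sup>2) = (\<Sum>q\<leftarrow>qs'. (B q)\<^sup>2) * c2 * (inverse c2)\<^sup>2"
      if "ys = map (\<lambda>(q, r). B q * C r * inverse c2) (List.product qs' qs)" for qs' ys
      unfolding that
      by (induction qs')
        (simp_all add: o_def c2_def sum_list_const_mult sum_list_mult_const power_mult_distrib algebra_simps)
    then show ?thesis using ys_def unfolding b2_def by blast
  qed
  moreover have "b2 * c2 * (inverse c2)\<^sup>2 = - a"
    proof -
    have "b2 = - (a * c2)" using eq' by (rule eq_neg_iff_add_eq_0[THEN iffD2])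
    then show ?thesis using \<open>c2 \<noteq> 0\<close> by (simp add: power2_eq_square field_simps)
  qed
  ultimately show ?thesis by auto
qed

text \<open>If neither were a square, both \<open>a\<close> and \<open>- a\<close> would be sums of
  squares. Their total is zero, so realness gives \<open>a = 0\<close>, a square after all.\<close>

lemma square_or_uminus_square:
  assumes a: "a \<in> S"
  shows "\<exists>c\<in>S. a = c\<^sup>2 \<or> - a = c\<^sup>2"
proof (rule ccontr)
  assume *: "\<not> ?thesis"
  obtain xs where xs: "set xs \<subseteq> S" "- a = (\<Sum>x\<leftarrow>xs. x\<^sup>2)"
    using uminus_sos_if_not_square[OF a] * by blast
  obtain ys where ys: "set ys \<subseteq> S" "a = (\<Sum>x\<leftarrow>ys. x\<^sup>2)"
    using uminus_sos_if_not_square[OF in_S(5)[OF a]] * by auto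
  have "(\<Sum>x\<leftarrow>xs @ ys. x\<^sup>2) = - a + a" unfolding map_append sum_list_append xs(2) ys(2)[symmetric] ..
  then have "\<forall>x\<in>set ys. x = 0"
    using real[unfolded real_set_def, rule_format, of "xs @ ys"] xs ys by auto
  then have "a = 0" unfolding ys(2) by (induction ys) auto
  then show False using * in_S(1) by auto
qed

end

section \<open>The intermediate value property from the lack of real extensions\<close>

lemma poly_list_sum_squares_neq_0:
  fixes gs :: "'a::linordered_field poly list"
  assumes "g \<in> set gs" "g \<noteq> 0"
  shows "(\<Sum>g\<leftarrow>gs. g\<^sup>2) \<noteq> 0"
proof -
  have "finite {x. poly g x = 0}" by (rule poly_roots_finite[OF assms(2)])
  then obtain t where t: "poly g t \<noteq> 0"
    using infinite_UNIV_char_0[where 'a = 'a] by (metis (mono_tags, lifting) UNIV_eq_I mem_Collect_eq)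
  have "0 < (poly g t)\<^sup>2" using t by simp
  also have "\<dots> \<le> (\<Sum>x\<leftarrow>map (\<lambda>g. (poly g t)\<^sup>2) gs. x)"
    using assms(1) by (intro member_le_sum_list) auto
  also have "\<dots> = poly (\<Sum>g\<leftarrow>gs. g\<^sup>2) t"
    by (induction gs) auto
  finally show ?thesis by auto
qed

lemma poly_sum_list_squares: "poly (\<Sum>g\<leftarrow>gs. g\<^sup>2) t = (\<Sum>g\<leftarrow>gs. (poly g t)\<^sup>2)"
  by (induction gs) auto

lemma sum_list_squares_eq_0_iff:
  "(\<Sum>g\<leftarrow>gs. (f g)\<^sup>2) = (0::'a::linordered_idom) \<longleftrightarrow> (\<forall>g\<in>set gs. f g = 0)"
proof (induction gs)
  case (Cons g gs)
  have "(\<Sum>g\<leftarrow>gs. (f g)\<^sup>2) \<ge> 0" by (intro sum_list_nonneg) auto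
  then show ?case using Cons by (simp add: add_nonneg_eq_0_iff)
qed auto

text \<open>\<open>f dvd \<Sum>g\<^sup>2\<close> is a certificate that \<open>K[t]/(f)\<close> is not real. In a certificate of minimal
  degree the cofactor has no root in \<open>K\<close>, hence changes sign wherever \<open>f\<close> does; but it has
  smaller degree than \<open>f\<close>.\<close>

lemma ivt_if_no_real_extension:
  fixes \<iota> :: "'k::linordered_field \<Rightarrow> 'c::alg_closed_field" and f :: "'k poly"
  assumes \<iota>: "ring_homo \<iota>"
    and ext: "\<And>\<theta>. \<theta> \<notin> range \<iota> \<Longrightarrow> \<exists>gs. (\<Sum>g\<leftarrow>gs. (poly (map_poly \<iota> g) \<theta>)\<^sup>2) = 0 \<and>
      (\<exists>g\<in>set gs. poly (map_poly \<iota> g) \<theta> \<noteq> 0)"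
    and "a < b" "poly f a * poly f b < 0"
  shows "\<exists>x. a < x \<and> x < b \<and> poly f x = 0"
  using assms(4)
proof (induction "degree f" arbitrary: f rule: less_induct)
  case less
  define d where "d = degree f"
  have IH: "\<exists>x. a < x \<and> x < b \<and> poly g x = 0" if "degree g < d" "poly g a * poly g b < 0" for g
    using less.hyps[of g] that by (simp add: d_def)
  note IM = map_poly_homo[OF \<iota>]
  have f0: "f \<noteq> 0" using less.prems by auto
  \<comment> \<open>A sign change of a product is inherited by one of the factors, to which the
    induction hypothesis applies.\<close>
  have split: ?case if "f = g * h" "degree g < d" "degree h < d" for g h
  proof -
    have "(poly g a * poly g b) * (poly h a * poly h b) < 0"
      using less.prems that(1) by (simp add: ac_simps)
    then have "poly g a * poly g b < 0 \<or> poly h a * poly h b < 0"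
      by (auto simp only: mult_less_0_iff[of "poly g a * poly g b"])
    then show ?case using IH that by (metis mult_eq_0_iff poly_mult)
  qed
  show ?case
  proof (cases "d \<le> 1")
    case True
    define m l where "m = coeff f 0" and "l = coeff f 1"
    have f: "f = [:m, l:]"
      by (rule poly_eqI) (use True in \<open>auto simp: m_def l_def coeff_pCons d_def coeff_eq_0 split: nat.split\<close>)
    have l: "l \<noteq> 0"
      using less.prems f by (auto simp: not_less)
    define r where "r = - m / l"
    have r: "poly f x = l * (x - r)" for x using l by (simp add: f r_def field_simps)
    have "l\<^sup>2 * ((a - r) * (b - r)) < 0"
      using less.prems by (simp add: r power2_eq_square ac_simps)
    then have "(a - r) * (b - r) < 0" using l by (simp add: mult_less_0_iff)
    then have "a < r" "r < b" using \<open>a < b\<close> by (auto simp: mult_less_0_iff)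
    then show ?thesis using r by auto
  next
    case False
    show ?thesis
    proof (rule ccontr)
      assume nr: "\<not> ?thesis"
      \<comment> \<open>This excludes roots outside the interval too: a linear factor could be split
        off, both factors having degree below \<open>d\<close> because \<open>d\<close> is at least
        2.\<close>
      have no_lin: "poly f c \<noteq> 0" for c
      proof
        assume "poly f c = 0"
        then obtain k where k: "f = [:- c, 1:] * k" by (auto simp: poly_eq_0_iff_dvd)
        then have "k \<noteq> 0" using f0 by auto
        have "degree f = degree [:- c, 1:] + degree k"
          unfolding k by (rule degree_mult_eq) (use \<open>k \<noteq> 0\<close> in auto)
        then have "d = Suc (degree k)" unfolding d_def by simp
        then show False using split[OF k] False nr by simp
      qed
      have \<iota>0: "\<iota> c \<noteq> 0" if "c \<noteq> 0" for c
      proof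
        assume "\<iota> c = 0"
        then have "\<iota> (c * inverse c) = 0" unfolding homo_mult[OF \<iota>] by simp
        then show False using that by (simp add: homo_1[OF \<iota>])
      qed
      have "degree (map_poly \<iota> f) = d"
        unfolding d_def by (rule degree_map_homo[OF \<iota> \<iota>0]) (use f0 in simp)
      then obtain \<theta> where \<theta>: "poly (map_poly \<iota> f) \<theta> = 0"
        using alg_closed_imp_poly_has_root[of "map_poly \<iota> f"] False by auto
      define E where "E g = poly (map_poly \<iota> g) \<theta>" for g
      have E: "ring_homo E" unfolding E_def by (rule ring_homo_comp[OF ring_homo_poly IM])
      \<comment> \<open>\<open>\<mu>\<close> is a minimal polynomial of \<open>\<theta>\<close>. By
        \<open>split\<close> its cofactor in \<open>f\<close> is constant, so \<open>f\<close>
        divides everything that vanishes at \<open>\<theta>\<close>.\<close>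
      obtain \<mu> where \<mu>: "\<mu> \<noteq> 0" "E \<mu> = 0" and least: "\<And>g. g \<noteq> 0 \<Longrightarrow> E g = 0 \<Longrightarrow> degree \<mu> \<le> degree g"
        using ex_has_least_nat[of "\<lambda>g. g \<noteq> 0 \<and> E g = 0" f degree] f0 \<theta> unfolding E_def by blast
      have \<mu>_dvd: "\<mu> dvd g" if "E g = 0" for g
      proof (rule ccontr)
        assume "\<not> \<mu> dvd g"
        then have nz: "g mod \<mu> \<noteq> 0" by (simp add: mod_eq_0_iff_dvd)
        have "E (g div \<mu> * \<mu> + g mod \<mu>) = 0" using that by simp
        then have "E (g mod \<mu>) = 0" using \<mu>(2) by (simp only: homo_add[OF E] homo_mult[OF E]) simp
        then show False using least[OF nz] degree_mod_less'[OF \<mu>(1) nz] by simp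
      qed
      obtain \<nu> where \<nu>: "f = \<mu> * \<nu>" using \<mu>_dvd[of f] \<theta> unfolding E_def by blast
      then have "\<nu> \<noteq> 0" using f0 by auto
      then have deg: "d = degree \<mu> + degree \<nu>" unfolding d_def \<nu> using \<mu>(1) by (simp add: degree_mult_eq)
      have "degree \<mu> \<noteq> 0"
      proof
        assume "degree \<mu> = 0"
        then obtain c where c: "\<mu> = [:c:]" by (metis degree_eq_zeroE)
        then show False using \<mu> \<iota>0[of c] by (simp add: E_def map_poly_homo_pCons[OF \<iota>])
      qed
      then have "degree \<nu> = 0" using split[OF \<nu>] nr deg by fastforce
      then have "is_unit \<nu>" using \<open>\<nu> \<noteq> 0\<close> by (simp add: is_unit_iff_degree)
      then have f_dvd: "f dvd g" if "E g = 0" for g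
        using \<mu>_dvd[OF that] \<nu> by (simp add: mult_unit_dvd_iff)
      have "\<theta> \<notin> range \<iota>"
      proof
        assume "\<theta> \<in> range \<iota>"
        then obtain c where "\<theta> = \<iota> c" by blast
        then have "\<iota> (poly f c) = 0" using \<theta> by (simp add: poly_map_homo[OF \<iota>])
        then show False using \<iota>0[OF no_lin[of c]] by simp
      qed
      then obtain gs0 where gs0: "(\<Sum>g\<leftarrow>gs0. (E g)\<^sup>2) = 0" "\<exists>g\<in>set gs0. E g \<noteq> 0"
        using ext[of \<theta>] unfolding E_def by blast
      define cert where "cert gs \<longleftrightarrow> (\<forall>g\<in>set gs. degree g < d) \<and> (\<exists>g\<in>set gs. g \<noteq> 0) \<and> f dvd (\<Sum>g\<leftarrow>gs. g\<^sup>2)" for gs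
      \<comment> \<open>Reduction modulo \<open>f\<close> leaves the values at
        \<open>\<theta>\<close> unchanged and brings the degrees below \<open>d\<close>.\<close>
      define gs1 where "gs1 = map (\<lambda>g. g mod f) gs0"
      have E_mod: "E (g mod f) = E g" for g
      proof -
        have "E g = E (g div f * f + g mod f)" by simp
        also have "\<dots> = E (g mod f)"
          using \<theta> by (simp only: homo_add[OF E] homo_mult[OF E]) (simp add: E_def)
        finally show ?thesis by simp
      qed
      have "cert gs1"
        unfolding cert_def
      proof (intro conjI)
        have "degree (g mod f) < d" for g
          using degree_mod_less[OF f0, of g] False by (auto simp: d_def)
        then show "\<forall>g\<in>set gs1. degree g < d"
          by (simp add: gs1_def)
        obtain g where "g \<in> set gs0" "E g \<noteq> 0" using gs0(2) by blast
        then have "g mod f \<in> set gs1" "g mod f \<noteq> 0"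
          using E_mod[of g] homo_0[OF E] by (auto simp: gs1_def)
        then show "\<exists>g\<in>set gs1. g \<noteq> 0" by blast
        show "f dvd (\<Sum>g\<leftarrow>gs1. g\<^sup>2)"
        proof (rule f_dvd)
          have "E (\<Sum>g\<leftarrow>gs1. g\<^sup>2) = (\<Sum>g\<leftarrow>gs0. (E (g mod f))\<^sup>2)"
            unfolding homo_sum_list[OF E] gs1_def by (simp add: o_def homo_power[OF E])
          then show "E (\<Sum>g\<leftarrow>gs1. g\<^sup>2) = 0" using gs0(1) by (simp add: E_mod)
        qed
      qed
      then obtain gs where gs: "cert gs"
        and min: "\<And>hs. cert hs \<Longrightarrow> degree (\<Sum>g\<leftarrow>gs. g\<^sup>2) \<le> degree (\<Sum>g\<leftarrow>hs. g\<^sup>2)"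
        using ex_has_least_nat[of cert gs1 "\<lambda>gs. degree (\<Sum>g\<leftarrow>gs. g\<^sup>2)"] by blast
      define G where "G = (\<Sum>g\<leftarrow>gs. g\<^sup>2)"
      have G0: "G \<noteq> 0" using gs poly_list_sum_squares_neq_0 unfolding cert_def G_def by blast
      obtain h where h: "G = f * h" using gs unfolding cert_def G_def by blast
      then have "h \<noteq> 0" using G0 by auto
      have "degree (\<Sum>g\<leftarrow>gs. g\<^sup>2) \<le> 2 * (d - 1)" if "\<forall>g\<in>set gs. degree g < d" for gs
        using that
      proof (induction gs)
        case (Cons g gs)
        have "degree (g\<^sup>2) \<le> degree g * 2" by (rule degree_power_le)
        moreover have "degree g < d" using Cons.prems by simp
        ultimately have "degree (g\<^sup>2) \<le> 2 * (d - 1)" by linarith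
        then show ?case using Cons by (simp add: degree_add_le)
      qed simp
      then have "degree G \<le> 2 * (d - 1)" using gs unfolding cert_def G_def by blast
      moreover have "degree G = d + degree h"
        unfolding h d_def by (rule degree_mult_eq[OF f0 \<open>h \<noteq> 0\<close>])
      \<comment> \<open>In fact \<open>degree h\<close> is at most
        \<open>2 * (d - 1) - d\<close>.\<close>
      ultimately have degh: "degree h < d" using False by simp
      \<comment> \<open>At a root \<open>c\<close> of \<open>h\<close> the sum of squares vanishes,
        so each \<open>g\<close> is divisible by \<open>[:- c, 1:]\<close>. Since \<open>f\<close>
        has no root at \<open>c\<close>, the square of this factor divides \<open>h\<close>;
        removing it leaves a certificate whose degree is smaller by 2.\<close>
      have h_no_root: "poly h c \<noteq> 0" for c
      proof
        assume c: "poly h c = 0"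
        then have "poly G c = 0" by (simp add: h)
        then have "\<forall>g\<in>set gs. poly g c = 0"
          unfolding G_def poly_sum_list_squares sum_list_squares_eq_0_iff .
        then have div: "g = [:- c, 1:] * (g div [:- c, 1:])" if "g \<in> set gs" for g
        proof -
          have "[:- c, 1:] dvd g" using that \<open>\<forall>g\<in>set gs. poly g c = 0\<close> by (simp add: poly_eq_0_iff_dvd)
          then show ?thesis by (rule dvd_mult_div_cancel[symmetric])
        qed
        define ks where "ks = map (\<lambda>g. g div [:- c, 1:]) gs"
        define K where "K = (\<Sum>k\<leftarrow>ks. k\<^sup>2)"
        have "G = (\<Sum>g\<leftarrow>gs. [:- c, 1:]\<^sup>2 * (g div [:- c, 1:])\<^sup>2)"
          unfolding G_def using div
          by (intro arg_cong[of _ _ sum_list] map_cong refl) (metis power_mult_distrib)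
        then have GK: "G = [:- c, 1:]\<^sup>2 * K"
          by (simp add: K_def ks_def o_def sum_list_const_mult)
        obtain h1 where h1: "h = [:- c, 1:] * h1" using c by (auto simp: poly_eq_0_iff_dvd)
        have "[:- c, 1:] * (f * h1) = [:- c, 1:] * ([:- c, 1:] * K)"
          using GK unfolding h h1 power2_eq_square by (simp only: ac_simps)
        then have 1: "f * h1 = [:- c, 1:] * K" by (simp only: mult_cancel_left) simp
        then have "poly f c * poly h1 c = 0" by (simp flip: poly_mult)
        then have "poly h1 c = 0" using no_lin[of c] by simp
        then obtain h2 where h2: "h1 = [:- c, 1:] * h2" by (auto simp: poly_eq_0_iff_dvd)
        have "[:- c, 1:] * (f * h2) = [:- c, 1:] * K"
          using 1 unfolding h2 by (simp only: ac_simps)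
        then have 2: "f * h2 = K" by (simp only: mult_cancel_left) simp
        have K0: "K \<noteq> 0" using G0 GK by auto
        have "cert ks"
          unfolding cert_def
        proof (intro conjI)
          show "\<forall>k\<in>set ks. degree k < d"
          proof
            fix k assume "k \<in> set ks"
            then obtain g where g: "g \<in> set gs" "k = g div [:- c, 1:]" by (auto simp: ks_def)
            have "degree g < d" using gs g(1) unfolding cert_def by blast
            show "degree k < d"
            proof (cases "k = 0")
              case False
              have "degree g = degree ([:- c, 1:] * k)" using div[OF g(1)] g(2) by simp
              also have "\<dots> = degree [:- c, 1:] + degree k"
                by (rule degree_mult_eq) (use False in auto)
              finally show ?thesis using \<open>degree g < d\<close> by simp
            qed (use \<open>degree g < d\<close> in simp)
          qed
          show "\<exists>k\<in>set ks. k \<noteq> 0"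
          proof (rule ccontr)
            assume "\<not> ?thesis"
            then have "(\<Sum>k\<leftarrow>ks. k\<^sup>2) = 0" by (induction ks) auto
            then show False using K0 by (simp add: K_def)
          qed
          show "f dvd (\<Sum>k\<leftarrow>ks. k\<^sup>2)" using 2 unfolding K_def by (metis dvd_triv_left)
        qed
        then have "degree G \<le> degree K" using min unfolding G_def K_def by blast
        moreover have "degree G = degree ([:- c, 1:]\<^sup>2) + degree K"
          unfolding GK using K0 by (intro degree_mult_eq) auto
        moreover have "degree ([:- c, 1:]\<^sup>2) = 2" by (simp add: degree_power_eq)
        ultimately show False by simp
      qed
      \<comment> \<open>As \<open>G = f * h\<close> is nonnegative while \<open>f\<close> changes
        sign, \<open>h\<close> changes sign too. The induction hypothesis then gives
        \<open>h\<close> a root, although it has none.\<close>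
      have "poly G t \<ge> 0" for t
        unfolding G_def poly_sum_list_squares by (intro sum_list_nonneg) auto
      then have "poly G a * poly G b \<ge> 0" by simp
      then have "(poly f a * poly f b) * (poly h a * poly h b) \<ge> 0"
        unfolding h by (simp add: ac_simps)
      moreover have "poly h a * poly h b \<noteq> 0" using h_no_root by simp
      ultimately have "poly h a * poly h b < 0"
        using less.prems mult_neg_pos[of "poly f a * poly f b" "poly h a * poly h b"]
        by (meson linorder_neqE_linordered_idom not_less)
      then show False using IH[OF degh] h_no_root by blast
    qed
  qed
qed


section \<open>The real closure as a type\<close>

definition fraction_embedding :: "'a::idom \<Rightarrow> 'a fract alg_closure" where
  "fraction_embedding a = to_ac (Fract a 1)"

lemma ring_homo_fraction_embedding: "ring_homo fraction_embedding"
  unfolding ring_homo_def fraction_embedding_def to_ac_add[symmetric] to_ac_mult[symmetric]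
  by (simp add: One_fract_def[symmetric])

lemma fraction_embedding_eq_0_iff: "fraction_embedding a = 0 \<longleftrightarrow> a = 0"
  by (simp add: fraction_embedding_def Zero_fract_def eq_fract)

definition is_real_closure :: "'a::real_domain fract alg_closure set \<Rightarrow> bool" where
  "is_real_closure S \<longleftrightarrow> subring_set S \<and> real_set S \<and> range fraction_embedding \<subseteq> S \<and>
    (\<forall>S'. subring_set S' \<longrightarrow> real_set S' \<longrightarrow> S \<subseteq> S' \<longrightarrow> S' = S)"

lemma real_closure_exists: "\<exists>S. is_real_closure S"
proof -
  define ok where "ok S \<longleftrightarrow> subring_set S \<and> real_set S \<and> range fraction_embedding \<subseteq> S"
    for S :: "'a::real_domain fract alg_closure set"
  have "\<exists>M\<in>Collect ok. \<forall>S\<in>Collect ok. M \<subseteq> S \<longrightarrow> S = M"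
  proof (rule subset_Zorn_nonempty)
    have "real_set (range (fraction_embedding :: 'a \<Rightarrow> _))"
      unfolding real_set_def
    proof (intro allI impI)
      fix xs :: "'a fract alg_closure list"
      assume xs: "set xs \<subseteq> range fraction_embedding" "(\<Sum>x\<leftarrow>xs. x\<^sup>2) = 0"
      then have "xs \<in> lists (range fraction_embedding)" by auto
      then obtain ys where ys: "xs = map fraction_embedding ys" unfolding lists_image by blast
      have "fraction_embedding (\<Sum>y\<leftarrow>ys. y * y) = 0"
        using xs(2) by (simp add: ys homo_sum_list[OF ring_homo_fraction_embedding]
          homo_mult[OF ring_homo_fraction_embedding] o_def power2_eq_square)
      then have "(\<Sum>y\<leftarrow>ys. y * y) = 0" by (simp add: fraction_embedding_eq_0_iff)
      then show "\<forall>x\<in>set xs. x = 0"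
        using sum_list_squares_eq_0[of ys] by (auto simp: ys fraction_embedding_eq_0_iff)
    qed
    then have "ok (range fraction_embedding)"
      using subring_image[OF ring_homo_fraction_embedding] by (simp add: ok_def)
    then show "Collect ok \<noteq> {}" by blast
  next
    fix C assume C: "C \<noteq> {}" "subset.chain (Collect ok) C"
    then have ok: "\<And>S. S \<in> C \<Longrightarrow> ok S" by (auto simp: subset_chain_def)
    \<comment> \<open>Realness is a condition on lists, and the finitely many entries of a list lie
      in a common member of the chain.\<close>
    have "\<exists>S\<in>C. set xs \<subseteq> S" if "set xs \<subseteq> \<Union>C" for xs
      using that
    proof (induction xs)
      case (Cons x xs)
      then obtain S T where "S \<in> C" "set xs \<subseteq> S" "T \<in> C" "x \<in> T" by auto
      moreover have "S \<subseteq> T \<or> T \<subseteq> S"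
        using C(2) calculation unfolding subset_chain_def by blast
      ultimately show ?case by auto
    qed (use C(1) in auto)
    then have "real_set (\<Union>C)"
      using ok unfolding real_set_def ok_def by meson
    then show "\<Union>C \<in> Collect ok"
      using subring_chain_Union[OF C] ok C(1) unfolding ok_def by blast
  qed
  then obtain M where M: "ok M" "\<And>S. ok S \<Longrightarrow> M \<subseteq> S \<Longrightarrow> S = M" by blast
  have "is_real_closure M"
    unfolding is_real_closure_def
  proof (intro conjI allI impI)
    fix S' assume "subring_set S'" "real_set S'" "M \<subseteq> S'"
    then show "S' = M" using M unfolding ok_def by blast
  qed (use M(1) in \<open>auto simp: ok_def\<close>)
  then show ?thesis by blast
qed

definition real_closure_set :: "'a::real_domain fract alg_closure set" where
  "real_closure_set = (SOME S. is_real_closure S)"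

lemma is_real_closure_set: "is_real_closure real_closure_set"
  unfolding real_closure_set_def by (rule someI_ex[OF real_closure_exists])

interpretation real_closure: maximal_real_subring real_closure_set
proof
qed (use is_real_closure_set in \<open>auto simp: is_real_closure_def\<close>)

typedef (overloaded) 'a::real_domain real_closure = "real_closure_set :: 'a fract alg_closure set"
  using real_closure.in_S(1) by blast

setup_lifting type_definition_real_closure

instantiation real_closure :: (real_domain) field
begin

lift_definition zero_real_closure :: "'a real_closure" is 0 by (rule real_closure.in_S)
lift_definition one_real_closure :: "'a real_closure" is 1 by (rule real_closure.in_S)
lift_definition plus_real_closure :: "'a real_closure \<Rightarrow> 'a real_closure \<Rightarrow> 'a real_closure"
  is "(+)" by (rule real_closure.in_S)
lift_definition minus_real_closure :: "'a real_closure \<Rightarrow> 'a real_closure \<Rightarrow> 'a real_closure"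
  is "(-)" by (rule real_closure.in_S)
lift_definition uminus_real_closure :: "'a real_closure \<Rightarrow> 'a real_closure"
  is uminus by (rule real_closure.in_S)
lift_definition times_real_closure :: "'a real_closure \<Rightarrow> 'a real_closure \<Rightarrow> 'a real_closure"
  is "(*)" by (rule real_closure.in_S)
lift_definition inverse_real_closure :: "'a real_closure \<Rightarrow> 'a real_closure"
  is inverse by (rule real_closure.inverse_in)

definition "x div y = x * inverse (y :: 'a real_closure)"

instance
  by standard (transfer; simp add: algebra_simps divide_real_closure_def)+

end

lemma ring_homo_Rep: "ring_homo Rep_real_closure"
  by (simp add: ring_homo_def one_real_closure.rep_eq plus_real_closure.rep_eq times_real_closure.rep_eq)

lemma real_closure_sum_squares_eq_0:
  fixes xs :: "'a::real_domain real_closure list"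
  assumes "(\<Sum>x\<leftarrow>xs. x\<^sup>2) = 0" "x \<in> set xs"
  shows "x = 0"
proof -
  let ?R = "Rep_real_closure :: 'a real_closure \<Rightarrow> _"
  have "(\<Sum>y\<leftarrow>map ?R xs. y\<^sup>2) = ?R (\<Sum>x\<leftarrow>xs. x\<^sup>2)"
    by (simp add: homo_sum_list[OF ring_homo_Rep] homo_power[OF ring_homo_Rep] o_def)
  then have "(\<Sum>y\<leftarrow>map ?R xs. y\<^sup>2) = 0"
    unfolding assms(1) homo_0[OF ring_homo_Rep] .
  moreover have "set (map ?R xs) \<subseteq> real_closure_set" using Rep_real_closure by auto
  ultimately have "\<forall>y\<in>set (map ?R xs). y = 0"
    using real_closure.real unfolding real_set_def by blast
  then have "?R x = ?R 0" using assms(2) by (simp add: zero_real_closure.rep_eq)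
  then show ?thesis by (simp add: Rep_real_closure_inject)
qed

lemma real_closure_square_or_uminus_square: "\<exists>c :: 'a::real_domain real_closure. a = c\<^sup>2 \<or> - a = c\<^sup>2"
  unfolding power2_eq_square
  by transfer (use real_closure.square_or_uminus_square in \<open>auto simp: power2_eq_square Bex_def\<close>)

text \<open>If \<open>- (a * a + b * b)\<close> is the square of \<open>c\<close>, then three
  squares sum to zero and all vanish. This supplies transitivity of the order.\<close>

lemma real_closure_sum_two_squares: "\<exists>c :: 'a::real_domain real_closure. a\<^sup>2 + b\<^sup>2 = c\<^sup>2"
proof -
  obtain c where c: "a\<^sup>2 + b\<^sup>2 = c\<^sup>2 \<or> - (a\<^sup>2 + b\<^sup>2) = c\<^sup>2"
    using real_closure_square_or_uminus_square by blast
  show ?thesis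
  proof (cases "a\<^sup>2 + b\<^sup>2 = c\<^sup>2")
    case False
    then have "c\<^sup>2 = - (a\<^sup>2 + b\<^sup>2)" using c by simp
    then have "(\<Sum>x\<leftarrow>[a, b, c]. x\<^sup>2) = 0" by simp
    then have "a = 0" "b = 0" using real_closure_sum_squares_eq_0[of "[a, b, c]"] by auto
    then show ?thesis by (intro exI[of _ 0]) simp
  qed blast
qed

text \<open>The order is dictated by the squares: totality is
  \<open>real_closure_square_or_uminus_square\<close>, and antisymmetry is realness.\<close>

instantiation real_closure :: (real_domain) linordered_field
begin

definition "a \<le> b \<longleftrightarrow> (\<exists>c. b - a = c\<^sup>2)" for a b :: "'a real_closure"
definition "a < b \<longleftrightarrow> a \<le> b \<and> a \<noteq> b" for a b :: "'a real_closure"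
definition "\<bar>a\<bar> = (if a < 0 then - a else a)" for a :: "'a real_closure"
definition "sgn a = (if a = 0 then 0 else if 0 < a then 1 else - 1)" for a :: "'a real_closure"

instance
proof
  fix a b c :: "'a real_closure"
  show antisym: "a = b" if ab: "a \<le> b" "b \<le> a" for a b :: "'a real_closure"
  proof -
    obtain c d where cd: "b - a = c\<^sup>2" "a - b = d\<^sup>2"
      using ab by (auto simp: less_eq_real_closure_def)
    have "(\<Sum>x\<leftarrow>[c, d]. x\<^sup>2) = 0" by (simp flip: cd)
    then have "c = 0" using real_closure_sum_squares_eq_0[of "[c, d]"] by auto
    then show ?thesis using cd by simp
  qed
  show refl: "a \<le> a" for a :: "'a real_closure"
    by (auto simp: less_eq_real_closure_def intro!: exI[of _ 0])
  show "a < b \<longleftrightarrow> a \<le> b \<and> \<not> b \<le> a"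
    using antisym[of a b] refl[of a] unfolding less_real_closure_def by blast
  show "a \<le> c" if abc: "a \<le> b" "b \<le> c"
  proof -
    obtain x y where "b - a = x\<^sup>2" "c - b = y\<^sup>2"
      using abc by (auto simp: less_eq_real_closure_def)
    then have "c - a = y\<^sup>2 + x\<^sup>2" by (simp flip: \<open>b - a = x\<^sup>2\<close> \<open>c - b = y\<^sup>2\<close>)
    then show ?thesis
      using real_closure_sum_two_squares[of y x] by (auto simp: less_eq_real_closure_def)
  qed
  show "a \<le> b \<or> b \<le> a"
    using real_closure_square_or_uminus_square[of "b - a"] by (auto simp: less_eq_real_closure_def)
  show "c + a \<le> c + b" if "a \<le> b"
    using that by (simp add: less_eq_real_closure_def)
  show "c * a < c * b" if ab: "a < b" "0 < c"
  proof -
    obtain x y where "b - a = x\<^sup>2" "c = y\<^sup>2"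
      using ab by (auto simp: less_real_closure_def less_eq_real_closure_def)
    then have "c * b - c * a = (y * x)\<^sup>2"
      by (simp add: power_mult_distrib flip: right_diff_distrib)
    then show ?thesis using ab by (auto simp: less_real_closure_def less_eq_real_closure_def)
  qed
qed (simp_all add: abs_real_closure_def sgn_real_closure_def)

end

instance real_closure :: (real_domain) real_closed_field
proof
  fix a b :: "'a real_closure" and c :: "nat \<Rightarrow> 'a real_closure" and n :: nat
  let ?R = "Rep_real_closure :: 'a real_closure \<Rightarrow> _"
  assume ab: "a < b" "(\<Sum>k\<le>n. c k * a ^ k) < 0" "0 < (\<Sum>k\<le>n. c k * b ^ k)"
  define f where "f = (\<Sum>k\<le>n. monom (c k) k)"
  have f: "poly f x = (\<Sum>k\<le>n. c k * x ^ k)" for x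
    by (simp add: f_def poly_sum poly_monom)
  have "\<exists>x. a < x \<and> x < b \<and> poly f x = 0"
  proof (rule ivt_if_no_real_extension[OF ring_homo_Rep _ ab(1)])
    fix \<theta> :: "'a fract alg_closure" assume "\<theta> \<notin> range ?R"
    then have "\<theta> \<notin> real_closure_set"
      by (metis Abs_real_closure_inverse rangeI)
    then obtain qs where qs: "set qs \<subseteq> polys_over real_closure_set"
      "(\<Sum>q\<leftarrow>qs. (poly q \<theta>)\<^sup>2) = 0" "\<exists>q\<in>set qs. poly q \<theta> \<noteq> 0"
      using real_closure.adjoin[of \<theta>] by blast
    define g where "g q = map_poly Abs_real_closure q" for q :: "'a fract alg_closure poly"
    have abs0: "Abs_real_closure 0 = (0 :: 'a real_closure)"
      by (simp add: zero_real_closure_def)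
    have g: "map_poly ?R (g q) = q" if "q \<in> set qs" for q
      using qs(1) that
      by (intro poly_eqI) (auto simp: g_def coeff_map_homo[OF ring_homo_Rep] coeff_map_poly abs0 polys_over_def
        intro!: Abs_real_closure_inverse)
    have "(\<Sum>h\<leftarrow>map g qs. (poly (map_poly ?R h) \<theta>)\<^sup>2) = (\<Sum>q\<leftarrow>qs. (poly q \<theta>)\<^sup>2)"
      using g by (auto intro!: arg_cong[of _ _ sum_list])
    moreover have "\<exists>h\<in>set (map g qs). poly (map_poly ?R h) \<theta> \<noteq> 0"
      using g qs(3) by auto
    ultimately show "\<exists>gs. (\<Sum>g\<leftarrow>gs. (poly (map_poly ?R g) \<theta>)\<^sup>2) = 0 \<and>
        (\<exists>g\<in>set gs. poly (map_poly ?R g) \<theta> \<noteq> 0)"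
      using qs(2) by (intro exI[of _ "map g qs"]) auto
  next
    show "poly f a * poly f b < 0" using ab(2,3) by (simp add: f mult_neg_pos)
  qed
  then show "\<exists>x. a < x \<and> x < b \<and> (\<Sum>k\<le>n. c k * x ^ k) = 0" by (simp add: f)
qed

definition to_real_closure :: "'a::real_domain \<Rightarrow> 'a real_closure" where
  "to_real_closure a = Abs_real_closure (fraction_embedding a)"

lemma Rep_to_real_closure: "Rep_real_closure (to_real_closure a) = fraction_embedding a"
  unfolding to_real_closure_def
  by (rule Abs_real_closure_inverse) (use is_real_closure_set in \<open>auto simp: is_real_closure_def\<close>)

lemma ring_homo_to_real_closure: "ring_homo to_real_closure"
  unfolding ring_homo_def Rep_real_closure_inject[symmetric] Rep_to_real_closure
    one_real_closure.rep_eq plus_real_closure.rep_eq times_real_closure.rep_eq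
  using ring_homo_fraction_embedding by (simp add: ring_homo_def)

section \<open>The weak real Nullstellensatz\<close>

lemma ring_homo_mconst: "ring_homo mconst"
  by (simp add: ring_homo_def mconst_def single_add mult_single)

lemma mvar_power: "mvar v ^ k = Poly_Mapping.single (Poly_Mapping.single v k) (1::'a::comm_semiring_1)"
  by (induction k) (simp_all add: mvar_def mult_single single_add[symmetric])

lemma meval_mconst_mvar: "meval mconst mvar p = (p :: ('v, 'a::comm_ring_1) mpoly)"
proof -
  have single_sum: "(\<Prod>v\<in>V. Poly_Mapping.single (e v) 1) = Poly_Mapping.single (sum e V) (1 :: 'a)"
    if "finite V" for V and e :: "'v \<Rightarrow> 'v \<Rightarrow>\<^sub>0 nat"
    using that by (induction V rule: finite_induct) (simp_all add: mult_single)
  have "(\<Prod>v\<in>Poly_Mapping.keys m. mvar v ^ Poly_Mapping.lookup m v) = Poly_Mapping.single m (1 :: 'a)"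
    for m :: "'v \<Rightarrow>\<^sub>0 nat"
    by (simp add: mvar_power single_sum flip: sum_monomials)
  then show ?thesis
    by (simp add: meval_def mconst_def mult_single flip: sum_monomials)
qed

text \<open>A type definition cannot depend on an ideal that occurs in a proof. Choosing once and for all a
  real prime that violates the Nullstellensatz, if there is one, makes its coordinate ring a type.\<close>

definition lacks_real_zero :: "('v, real) mpoly set \<Rightarrow> bool" where
  "lacks_real_zero J \<longleftrightarrow> real_prime J \<and> (\<exists>g\<in>J. \<forall>y. meval id y g \<noteq> 0)"

text \<open>The conditional form makes the choice a real prime in either case, so that the instances
  for its coordinate ring hold unconditionally.\<close>

definition chosen_prime :: "('v, real) mpoly set" where
  "chosen_prime = (SOME J. real_prime J \<and>
    ((\<exists>J' :: ('v, real) mpoly set. lacks_real_zero J') \<longrightarrow> lacks_real_zero J))"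

lemma is_sos_real_iff: "is_sos (a :: real) \<longleftrightarrow> a \<ge> 0"
proof
  assume "a \<ge> 0"
  then have "a = (sqrt a)\<^sup>2" by simp
  then show "is_sos a" using is_sos_square by metis
qed (auto simp: is_sos_def intro!: sum_list_nonneg)

lemma is_sos_homo: "ring_homo h \<Longrightarrow> is_sos a \<Longrightarrow> is_sos (h a)"
  unfolding is_sos_def
  by (elim exE, rename_tac qs, rule_tac x = "map h qs" in exI)
    (simp add: homo_sum_list homo_power o_def)

text \<open>Applied to evaluation at the origin, this provides a real prime for the choice when
  nothing violates the Nullstellensatz.\<close>

lemma real_prime_vanishing:
  assumes h: "ring_homo (h :: 'a::comm_ring_1 \<Rightarrow> real)"
  shows "real_prime {p. h p = 0}"
  unfolding real_prime_def ideal_set_def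
proof (intro conjI ballI allI impI)
  fix a s assume "is_sos s" "a\<^sup>2 + s \<in> {p. h p = 0}"
  then have "(h a)\<^sup>2 + h s = 0" "h s \<ge> 0"
    using is_sos_homo[OF h, of s] by (simp_all add: homo_add[OF h] homo_power[OF h] is_sos_real_iff)
  moreover have "(h a)\<^sup>2 \<ge> 0" by simp
  ultimately have "(h a)\<^sup>2 = 0" by linarith
  then show "a \<in> {p. h p = 0}" by simp
qed (auto simp: homo_0[OF h] homo_1[OF h] homo_add[OF h] homo_mult[OF h])

lemma chosen_prime:
  "real_prime (chosen_prime :: ('v, real) mpoly set)"
  "lacks_real_zero (J :: ('v, real) mpoly set) \<Longrightarrow> lacks_real_zero (chosen_prime :: ('v, real) mpoly set)"
proof -
  have "\<exists>J :: ('v, real) mpoly set. real_prime J \<and> ((\<exists>J' :: ('v, real) mpoly set. lacks_real_zero J') \<longrightarrow> lacks_real_zero J)"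
  proof (cases "\<exists>J' :: ('v, real) mpoly set. lacks_real_zero J'")
    case True
    then show ?thesis unfolding lacks_real_zero_def by blast
  next
    case False
    then show ?thesis
      using real_prime_vanishing[OF ring_homo_meval[OF ring_homo_id, of "\<lambda>_. 0"]] by blast
  qed
  from someI_ex[OF this]
  show "real_prime (chosen_prime :: ('v, real) mpoly set)"
    "lacks_real_zero J \<Longrightarrow> lacks_real_zero (chosen_prime :: ('v, real) mpoly set)"
    unfolding chosen_prime_def[symmetric] by blast+
qed

lemma chosen_ideal:
  "0 \<in> chosen_prime" "a \<in> chosen_prime \<Longrightarrow> b \<in> chosen_prime \<Longrightarrow> a + b \<in> chosen_prime"
  "b \<in> chosen_prime \<Longrightarrow> c * b \<in> chosen_prime" "a \<in> chosen_prime \<Longrightarrow> - a \<in> chosen_prime"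
  using chosen_prime(1) ideal_set_uminus unfolding real_prime_def ideal_set_def by blast+

lemma zero_minus_one_notin_chosen_prime: "0 - 1 \<notin> chosen_prime"
  using chosen_prime(1) chosen_ideal(4)[of "0 - 1"] unfolding real_prime_def by auto

lemma chosen_prime_prime: "a * b \<in> chosen_prime \<longleftrightarrow> a \<in> chosen_prime \<or> b \<in> chosen_prime"
  using chosen_prime(1) chosen_ideal(3)[of a b] chosen_ideal(3)[of b a]
  unfolding real_prime_def by (metis mult.commute)

\<comment> \<open>The coordinate ring of the chosen prime\<close>
quotient_type 'v coord = "('v, real) mpoly" / "\<lambda>p q. p - q \<in> chosen_prime"
proof (rule equivpI)
  show "reflp (\<lambda>p q. p - q \<in> (chosen_prime :: ('v, real) mpoly set))"
    by (rule reflpI) (simp add: chosen_ideal)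
  show "symp (\<lambda>p q. p - q \<in> (chosen_prime :: ('v, real) mpoly set))"
  proof (rule sympI)
    fix p q :: "('v, real) mpoly" assume "p - q \<in> chosen_prime"
    from chosen_ideal(4)[OF this] show "q - p \<in> chosen_prime" by simp
  qed
  show "transp (\<lambda>p q. p - q \<in> (chosen_prime :: ('v, real) mpoly set))"
  proof (rule transpI)
    fix p q r :: "('v, real) mpoly" assume "p - q \<in> chosen_prime" "q - r \<in> chosen_prime"
    from chosen_ideal(2)[OF this] show "p - r \<in> chosen_prime" by simp
  qed
qed

instantiation coord :: (type) comm_ring_1
begin

lift_definition zero_coord :: "'v coord" is 0 .
lift_definition one_coord :: "'v coord" is 1 .

lift_definition plus_coord :: "'v coord \<Rightarrow> 'v coord \<Rightarrow> 'v coord" is "(+)"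
proof -
  fix p p' q q' :: "('v, real) mpoly"
  assume "p - p' \<in> chosen_prime" "q - q' \<in> chosen_prime"
  from chosen_ideal(2)[OF this] show "p + q - (p' + q') \<in> chosen_prime" by (simp add: algebra_simps)
qed

lift_definition uminus_coord :: "'v coord \<Rightarrow> 'v coord" is uminus
proof -
  fix p p' :: "('v, real) mpoly" assume "p - p' \<in> chosen_prime"
  from chosen_ideal(4)[OF this] show "- p - - p' \<in> chosen_prime" by simp
qed

lift_definition minus_coord :: "'v coord \<Rightarrow> 'v coord \<Rightarrow> 'v coord" is "(-)"
proof -
  fix p p' q q' :: "('v, real) mpoly"
  assume "p - p' \<in> chosen_prime" "q - q' \<in> chosen_prime"
  from chosen_ideal(2)[OF this(1) chosen_ideal(4)[OF this(2)]]
  show "p - q - (p' - q') \<in> chosen_prime" by (simp add: algebra_simps)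
qed

lift_definition times_coord :: "'v coord \<Rightarrow> 'v coord \<Rightarrow> 'v coord" is "(*)"
proof -
  fix p p' q q' :: "('v, real) mpoly"
  assume "p - p' \<in> chosen_prime" "q - q' \<in> chosen_prime"
  from chosen_ideal(2)[OF chosen_ideal(3)[OF this(1), of q] chosen_ideal(3)[OF this(2), of p']]
  show "p * q - p' * q' \<in> chosen_prime" by (simp add: algebra_simps)
qed

instance
proof
  show "(0 :: 'v coord) \<noteq> 1"
    by transfer (rule zero_minus_one_notin_chosen_prime)
qed (transfer; simp add: algebra_simps chosen_ideal(1))+

end

instance coord :: (type) idom
proof
  fix a b :: "'v coord"
  show "a \<noteq> 0 \<Longrightarrow> b \<noteq> 0 \<Longrightarrow> a * b \<noteq> 0"
    by transfer (simp add: chosen_prime_prime)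
qed

lemma abs_coord_eq_0_iff: "abs_coord p = 0 \<longleftrightarrow> p \<in> chosen_prime"
  unfolding zero_coord_def coord.abs_eq_iff by simp

lemma ring_homo_abs_coord: "ring_homo abs_coord"
  by (simp add: ring_homo_def one_coord_def plus_coord.abs_eq times_coord.abs_eq)

lemma surj_abs_coord: "range abs_coord = UNIV"
proof -
  have "a \<in> range abs_coord" for a :: "'v coord"
    by (induction a rule: coord.abs_induct) simp
  then show ?thesis by blast
qed

instance coord :: (type) real_domain
proof
  fix xs :: "'v coord list" and x
  assume xs: "(\<Sum>x\<leftarrow>xs. x * x) = 0" "x \<in> set xs"
  have "xs \<in> lists (range abs_coord)" by (simp add: surj_abs_coord)
  then obtain ps where ps: "xs = map abs_coord ps" unfolding lists_image by blast
  then obtain p where p: "p \<in> set ps" "x = abs_coord p" using xs(2) by auto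
  have "abs_coord (\<Sum>p\<leftarrow>ps. p\<^sup>2) = 0"
    using xs(1) by (simp add: ps homo_sum_list[OF ring_homo_abs_coord] homo_mult[OF ring_homo_abs_coord]
      o_def power2_eq_square)
  \<comment> \<open>One occurrence of \<open>p\<close> is set aside, so that the realness clause of
    the prime applies to it.\<close>
  then have "p\<^sup>2 + (\<Sum>p\<leftarrow>remove1 p ps. p\<^sup>2) \<in> chosen_prime"
    by (simp add: abs_coord_eq_0_iff sum_list_map_remove1[OF p(1)])
  moreover have "is_sos (\<Sum>p\<leftarrow>remove1 p ps. p\<^sup>2)" unfolding is_sos_def by blast
  ultimately have "p \<in> chosen_prime"
    using chosen_prime(1) unfolding real_prime_def by blast
  then show "x = 0" by (simp add: p abs_coord_eq_0_iff)
qed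

text \<open>The classes of the variables form a zero of every \<open>g\<close> in the prime over the
  real closure of the coordinate ring. Transferring the sign 0 of this one polynomial yields a real
  zero.\<close>

lemma chosen_prime_has_real_zero: "\<not> lacks_real_zero (chosen_prime :: ('v::finite, real) mpoly set)"
proof
  assume "lacks_real_zero (chosen_prime :: ('v, real) mpoly set)"
  then obtain g :: "('v, real) mpoly" where g: "g \<in> chosen_prime" "\<And>y. meval id y g \<noteq> 0"
    unfolding lacks_real_zero_def by blast
  define \<phi> :: "('v, real) mpoly \<Rightarrow> 'v coord real_closure" where "\<phi> p = to_real_closure (abs_coord p)" for p
  have \<phi>: "ring_homo \<phi>"
    unfolding \<phi>_def by (rule ring_homo_comp[OF ring_homo_to_real_closure ring_homo_abs_coord])
  have "ring_homo (\<lambda>c. \<phi> (mconst c))" by (rule ring_homo_comp[OF \<phi> ring_homo_mconst])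
  from transfer_signs_to_reals[OF this, of "{g}" "\<lambda>v. \<phi> (mvar v)"]
  obtain y where "isgn (meval id y g) = isgn (meval (\<lambda>c. \<phi> (mconst c)) (\<lambda>v. \<phi> (mvar v)) g)" by auto
  also have "meval (\<lambda>c. \<phi> (mconst c)) (\<lambda>v. \<phi> (mvar v)) g = \<phi> g"
    unfolding homo_meval[OF \<phi>, symmetric] meval_mconst_mvar ..
  also have "abs_coord g = 0" using g(1) by (simp add: abs_coord_eq_0_iff)
  then have "\<phi> g = 0" by (simp add: \<phi>_def homo_0[OF ring_homo_to_real_closure])
  finally have "meval id y g = 0"
    unfolding isgn_0 isgn_eq_0_iff .
  then show False using g(2) by blast
qed

theorem weak_real_nullstellensatz:
  fixes g :: "('v::finite, real) mpoly"
  assumes "\<And>y. meval id y g \<noteq> 0"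
  shows "\<exists>q H. is_sos H \<and> q * g + H + 1 = 0"
proof (rule ccontr)
  assume no: "\<not> ?thesis"
  define I where "I = range (\<lambda>q. q * g)"
  have "ideal_set I"
    unfolding ideal_set_def
  proof (intro conjI ballI allI)
    show "0 \<in> I" unfolding I_def by (rule image_eqI[of _ _ 0]) auto
    fix a b assume "a \<in> I" "b \<in> I"
    then obtain p q where "a = p * g" "b = q * g" unfolding I_def by blast
    then show "a + b \<in> I" unfolding I_def by (intro image_eqI[of _ _ "p + q"]) (auto simp: distrib_right)
  next
    fix c b assume "b \<in> I"
    then obtain q where "b = q * g" unfolding I_def by blast
    then show "c * b \<in> I" unfolding I_def by (intro image_eqI[of _ _ "c * q"]) (auto simp: mult.assoc)
  qed
  moreover have "1 + s \<notin> I" if s: "is_sos s" for s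
  proof
    assume "1 + s \<in> I"
    then obtain q where "1 + s = q * g" unfolding I_def by blast
    then have "(- q) * g + s + 1 = 0" by (simp add: algebra_simps)
    then show False using no s by blast
  qed
  ultimately obtain J where J: "real_prime J" "I \<subseteq> J" using real_prime_exists by blast
  have "1 * g \<in> I" unfolding I_def by blast
  then have "g \<in> J" using J(2) by auto
  \<comment> \<open>\<open>J\<close> need not be the chosen prime, but its existence forces the
    chosen prime to be a violation as well.\<close>
  then have "lacks_real_zero J" using J(1) assms unfolding lacks_real_zero_def by blast
  then show False using chosen_prime(2) chosen_prime_has_real_zero by blast
qed

section \<open>Coamoebas\<close>

text \<open>\<open>Arg\<close> takes values in the half-open interval from \<open>- pi\<close> to
  \<open>pi\<close>, which contains no multiple of \<open>2 * pi\<close> except 0.\<close>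

lemma arg_eq_0_iff: "arg z = 0 \<longleftrightarrow> Arg z = 0"
proof -
  have "k = 0" if "Arg z = 2 * pi * real_of_int k" for k
  proof -
    have "- pi < 2 * pi * real_of_int k" "2 * pi * real_of_int k \<le> pi"
      using that Arg_bounded[of z] by auto
    then have "- 1 < 2 * real_of_int k" "2 * real_of_int k \<le> 1"
      using mult_less_cancel_left_pos[of pi "- 1" "2 * real_of_int k"]
        mult_le_cancel_left_pos[of pi "2 * real_of_int k" 1] by (simp_all add: ac_simps)
    then show ?thesis by linarith
  qed
  then have "(\<exists>k::int. Arg z - 0 = 2 * pi * real_of_int k) \<longleftrightarrow> Arg z = 0" by force
  then show ?thesis by transfer
qed

lemma module_times: "Modules.module ((*) :: 'a::comm_ring_1 \<Rightarrow> 'a \<Rightarrow> 'a)"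
  by unfold_locales (simp_all add: algebra_simps)

lemma vanishes_on_ideal_of:
  assumes "ring_homo h" "\<And>p. p \<in> F \<Longrightarrow> h p = 0" "p \<in> ideal_of F"
  shows "h p = 0"
proof -
  have "module.subspace (*) {p. h p = 0}"
    by (rule Modules.module.subspaceI[OF module_times])
      (simp_all add: homo_0[OF assms(1)] homo_add[OF assms(1)] homo_mult[OF assms(1)])
  from Modules.module.span_induct[OF module_times _ this, of p F] show ?thesis
    using assms(2,3) by (simp add: ideal_of_def)
qed

lemma ideal_of_superset: "F \<subseteq> ideal_of F"
  unfolding ideal_of_def by (rule Modules.module.span_superset[OF module_times])

lemma variety_ideal_of: "variety (ideal_of F) = {z. \<forall>p\<in>F. meval id (vec_nth z) p = 0}"
  unfolding variety_def
  using vanishes_on_ideal_of[OF ring_homo_meval[OF ring_homo_id]] ideal_of_superset by blast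

text \<open>\<open>R\<close> stands for \<open>Re\<close> and \<open>Im\<close>. At a real point all
  monomials have real values, so a real-linear \<open>R\<close> passes through to the
  coefficients.\<close>

lemma meval_map_part:
  assumes R: "R 0 = 0" "\<And>x y. R (x + y) = R x + R y" "\<And>c x. R (c * complex_of_real x) = R c * x"
  shows "meval id w (Poly_Mapping.map R p) = R (meval id (\<lambda>v. complex_of_real (w v)) p)"
proof -
  have R_sum: "R (\<Sum>m\<in>A. g m) = (\<Sum>m\<in>A. R (g m))" if "finite A" for A and g :: "'b \<Rightarrow> complex"
    using that by (induction A rule: finite_induct) (simp_all add: R)
  have lookup: "Poly_Mapping.lookup (Poly_Mapping.map R p) m = R (Poly_Mapping.lookup p m)" for m
    by (simp add: map.rep_eq "when_def" R)
  have "Poly_Mapping.keys (Poly_Mapping.map R p) \<subseteq> Poly_Mapping.keys p"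
    by (auto simp: in_keys_iff lookup R)
  from meval_eq_sum_superset[OF ring_homo_id finite_keys this]
  have "meval id w (Poly_Mapping.map R p) =
      (\<Sum>m\<in>Poly_Mapping.keys p. R (Poly_Mapping.lookup p m) * monomial_value w m)"
    by (simp add: lookup)
  then show ?thesis
    by (simp add: meval_def monomial_value_def R_sum R flip: of_real_power of_real_prod)
qed

definition square_point :: "('n + 'n \<Rightarrow> real) \<Rightarrow> 'n \<Rightarrow> complex" where
  "square_point w k = complex_of_real ((w (Inl k))\<^sup>2) + \<i> * complex_of_real (w (Inr k))"

lemma meval_id_mconst:
  fixes w :: "'v \<Rightarrow> 'a::comm_ring_1"
  shows "(\<lambda>c. meval id w (mconst c)) = id"
  by (rule ext) (simp add: meval_mconst[OF ring_homo_id])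

lemma meval_subst_XiY:
  "meval id w (subst_XiY p) = meval id (\<lambda>k. w (Inl k) + \<i> * w (Inr k)) p"
proof -
  note E = ring_homo_meval[OF ring_homo_id, of w]
  show ?thesis
    unfolding subst_XiY_def homo_meval[OF E] meval_id_mconst homo_add[OF E] homo_mult[OF E]
      meval_mconst[OF ring_homo_id] meval_mvar[OF ring_homo_id] id_apply ..
qed

lemma meval_subst_X2Y:
  "meval id w (subst_X2Y p) = meval id (case_sum (\<lambda>k. (w (Inl k))\<^sup>2) (\<lambda>k. w (Inr k))) p"
proof -
  note E = ring_homo_meval[OF ring_homo_id, of w]
  have "(\<lambda>v. meval id w (case_sum (\<lambda>k. (mvar (Inl k))\<^sup>2) (\<lambda>k. mvar (Inr k)) v)) =
      case_sum (\<lambda>k. (w (Inl k))\<^sup>2) (\<lambda>k. w (Inr k))"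
    by (rule ext) (simp add: homo_power[OF E] meval_mvar[OF ring_homo_id] split: sum.split)
  then show ?thesis
    unfolding subst_X2Y_def homo_meval[OF E] meval_id_mconst by simp
qed

lemma meval_subst_X2Y_parts:
  "meval id w (subst_X2Y (re_part p)) = Re (meval id (square_point w) p)"
  "meval id w (subst_X2Y (im_part p)) = Im (meval id (square_point w) p)"
  unfolding meval_subst_X2Y re_part_def im_part_def square_point_def
  by (simp_all add: meval_map_part meval_subst_XiY)

lemma sum_of_squares_iff_is_sos: "sum_of_squares H \<longleftrightarrow> is_sos H"
  by (simp add: sum_of_squares_def is_sos_def)

theorem theorem3p6:
  fixes f :: "nat \<Rightarrow> ('n::finite, complex) mpoly" and r :: nat
  shows "(0 :: angle ^ 'n) \<in> - modified_coamoeba (ideal_of (f ` {1..r})) \<longleftrightarrow>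
    (\<exists>(c :: nat \<Rightarrow> ('n + 'n, real) mpoly) (c' :: nat \<Rightarrow> ('n + 'n, real) mpoly)
       (d :: 'n \<Rightarrow> ('n + 'n, real) mpoly) (H :: ('n + 'n, real) mpoly).
       sum_of_squares H \<and>
       (\<Sum>j=1..r. c j * subst_X2Y (re_part (f j))) +
       (\<Sum>j=1..r. c' j * subst_X2Y (im_part (f j))) +
       (\<Sum>k\<in>UNIV. d k * Y k) + H + 1 = 0)"
proof
  define re where "re j = subst_X2Y (re_part (f j))" for j
  define im where "im j = subst_X2Y (im_part (f j))" for j
  assume L: "(0 :: angle ^ 'n) \<in> - modified_coamoeba (ideal_of (f ` {1..r}))"
  define G :: "('n + 'n, real) mpoly" where
    "G = (\<Sum>j=1..r. (re j)\<^sup>2) + (\<Sum>j=1..r. (im j)\<^sup>2) + (\<Sum>k\<in>UNIV. (Y k)\<^sup>2)"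
  have "meval id w G \<noteq> 0" for w
  proof
    assume G: "meval id w G = 0"
    note E = ring_homo_meval[OF ring_homo_id, of w]
    have "(\<Sum>j=1..r. (meval id w (re j))\<^sup>2) + (\<Sum>j=1..r. (meval id w (im j))\<^sup>2) +
        (\<Sum>k\<in>UNIV. (w (Inr k))\<^sup>2) = 0"
      using G by (simp add: G_def homo_add[OF E] homo_sum[OF E] homo_power[OF E] meval_mvar[OF ring_homo_id])
    moreover have "(\<Sum>j=1..r. (meval id w (re j))\<^sup>2) \<ge> 0" "(\<Sum>j=1..r. (meval id w (im j))\<^sup>2) \<ge> 0"
      "(\<Sum>k\<in>UNIV. (w (Inr k))\<^sup>2) \<ge> 0" by (simp_all add: sum_nonneg)
    ultimately have "(\<Sum>j=1..r. (meval id w (re j))\<^sup>2) = 0" "(\<Sum>j=1..r. (meval id w (im j))\<^sup>2) = 0"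
      "(\<Sum>k\<in>UNIV. (w (Inr k))\<^sup>2) = 0" by linarith+
    then have zero: "\<And>j. j \<in> {1..r} \<Longrightarrow> meval id w (re j) = 0" "\<And>j. j \<in> {1..r} \<Longrightarrow> meval id w (im j) = 0"
      "\<And>k. w (Inr k) = 0" by (simp_all add: sum_nonneg_eq_0_iff)
    \<comment> \<open>A zero of \<open>G\<close> has vanishing \<open>Y\<close> coordinates, so the
      associated complex point has nonnegative real coordinates. Those equal to 0 also have argument
      0, by the convention for \<open>Arg\<close>.\<close>
    define z :: "complex ^ 'n" where "z = (\<chi> k. complex_of_real ((w (Inl k))\<^sup>2))"
    have z: "vec_nth z = square_point w" by (rule ext) (simp add: z_def square_point_def zero(3))
    have "meval id (vec_nth z) (f j) = 0" if "j \<in> {1..r}" for j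
      using zero(1,2)[OF that] unfolding z re_def im_def meval_subst_X2Y_parts by (simp add: complex_eq_iff)
    then have "z \<in> variety (ideal_of (f ` {1..r}))" by (simp add: variety_ideal_of)
    moreover have "arg (vec_nth z k) = 0" for k
      by (simp add: arg_eq_0_iff z_def Arg_eq_0 flip: of_real_power)
    ultimately have "0 \<in> modified_coamoeba (ideal_of (f ` {1..r}))"
      unfolding modified_coamoeba_def by (auto intro!: bexI[of _ z])
    then show False using L by blast
  qed
  then obtain q H where H: "is_sos H" "q * G + H + 1 = 0" using weak_real_nullstellensatz by blast
  show "\<exists>c c' d H. sum_of_squares H \<and>
      (\<Sum>j=1..r. c j * subst_X2Y (re_part (f j))) + (\<Sum>j=1..r. c' j * subst_X2Y (im_part (f j))) +
      (\<Sum>k\<in>UNIV. d k * Y k) + H + 1 = 0"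
    using H
    \<comment> \<open>Expanding \<open>q * G\<close> and giving one factor of each square to
      \<open>q\<close> produces the coefficients.\<close>
    by (intro exI[of _ "\<lambda>j. q * re j"] exI[of _ "\<lambda>j. q * im j"] exI[of _ "\<lambda>k. q * Y k"] exI[of _ H])
      (simp add: sum_of_squares_iff_is_sos re_def im_def G_def distrib_left sum_distrib_left
        power2_eq_square mult.assoc)
next
  assume "\<exists>c c' d H. sum_of_squares H \<and>
      (\<Sum>j=1..r. c j * subst_X2Y (re_part (f j))) + (\<Sum>j=1..r. c' j * subst_X2Y (im_part (f j))) +
      (\<Sum>k\<in>UNIV. d k * Y k) + H + 1 = 0"
  then obtain c c' d H where sos: "sum_of_squares H"
    and R: "(\<Sum>j=1..r. c j * subst_X2Y (re_part (f j))) + (\<Sum>j=1..r. c' j * subst_X2Y (im_part (f j))) +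
      (\<Sum>k\<in>UNIV. d k * Y k) + H + 1 = 0" by blast
  show "(0 :: angle ^ 'n) \<in> - modified_coamoeba (ideal_of (f ` {1..r}))"
  proof
    assume "0 \<in> modified_coamoeba (ideal_of (f ` {1..r}))"
    then obtain z where z: "z \<in> variety (ideal_of (f ` {1..r}))" "\<And>k. arg (vec_nth z k) = 0 \<or> vec_nth z k = 0"
      unfolding modified_coamoeba_def by auto
    have nonneg: "vec_nth z k \<in> \<real>" "0 \<le> Re (vec_nth z k)" for k
      using z(2)[of k] by (auto simp: arg_eq_0_iff Arg_eq_0)
    \<comment> \<open>The coordinates of \<open>z\<close> are nonnegative reals, so their square
      roots give a real point at which \<open>square_point\<close> returns \<open>z\<close>.\<close>
    define w :: "'n + 'n \<Rightarrow> real" where "w = case_sum (\<lambda>k. sqrt (Re (vec_nth z k))) (\<lambda>_. 0)"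
    have w_Inr: "w (Inr k) = 0" for k by (simp add: w_def)
    have "square_point w = vec_nth z"
      by (rule ext) (use nonneg in \<open>simp add: square_point_def w_def complex_is_Real_iff complex_eq_iff\<close>)
    moreover have "meval id (vec_nth z) (f j) = 0" if "j \<in> {1..r}" for j
      using z(1) that by (auto simp: variety_ideal_of)
    ultimately have zero: "meval id w (subst_X2Y (re_part (f j))) = 0" "meval id w (subst_X2Y (im_part (f j))) = 0"
      if "j \<in> {1..r}" for j
      using that by (simp_all add: meval_subst_X2Y_parts)
    note E = ring_homo_meval[OF ring_homo_id, of w]
    have "is_sos H" using sos by (simp add: sum_of_squares_iff_is_sos)
    \<comment> \<open>At \<open>w\<close> the three sums of the identity vanish, leaving
      \<open>H + 1 = 0\<close> with a nonnegative value of \<open>H\<close>.\<close>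
    from is_sos_homo[OF E this] have "meval id w H \<ge> 0" by (simp add: is_sos_real_iff)
    moreover have "meval id w ((\<Sum>j=1..r. c j * subst_X2Y (re_part (f j))) +
        (\<Sum>j=1..r. c' j * subst_X2Y (im_part (f j))) + (\<Sum>k\<in>UNIV. d k * Y k) + H + 1) = 0"
      unfolding R by (rule homo_0[OF E])
    then have "meval id w H + 1 = 0"
      by (simp add: homo_add[OF E] homo_sum[OF E] homo_mult[OF E] homo_1[OF E] zero
          meval_mvar[OF ring_homo_id] w_Inr)
    ultimately show False by simp
  qed
qed

end
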